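(* Let $a_n=\binom{2n}{n}^3$ for $n\ge 0$. Then for each $k\in\mathbb{N}$, $$\mathcal{M}^{(k)}_n(\boldsymbol{a}) \sim \frac{e^{6n\ln 2}}{(n\pi)^{3/2}}\left(\frac{\pi}{\Gamma(3/4)^4}\right)^{k-1}k\quad\text{as } n\to\infty.$$ Moreover, let $\mathbf{P}^{\mathrm{3SRWB}}_n$ be the law of three independent uniformly random simple random walk bridges of length $2n$, $(x^{(i)}_0,\dots,x^{(i)}_{2n})$, $i=1,2,3$ (each with $x^{(i)}_0=0$, steps $\pm1$, $x^{(i)}_{2n}=0$), let $\mathfrak{Z}_n=\{0\}\cup\{t\in\{1,\dots,n\}: x^{(1)}_{2t}=x^{(2)}_{2t}=x^{(3)}_{2t}=0\}$, and let $p=\Gamma(3/4)^4/\pi$. Then for each $k\in\{2,3,\dots\}$, $$\lim_{n\to\infty}\mathbf{P}^{\mathrm{3SRWB}}_n(|\mathfrak{Z}_n|=k) = (k-1)(1-p)^{k-2}p^2.$$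
   Context: For a sequence $\boldsymbol{a}=(a_n)_{n\ge 0}$ and $k\in\mathbb{N}$, the $k$-fold convolution is $\mathcal{M}^{(k)}_n(\boldsymbol{a}) = \sum_{j_1,\dots,j_k\ge 0,\ j_1+\dots+j_k=n} a_{j_1}\cdots a_{j_k}$. *)

theory Defs
  imports "HOL-Probability.Probability" "HOL-Library.Landau_Symbols"
begin

definition convolution_fold :: "nat \<Rightarrow> (nat \<Rightarrow> real) \<Rightarrow> nat \<Rightarrow> real" where
  "convolution_fold k a n =
     (\<Sum>js | length js = k \<and> sum_list js = n. \<Prod>i<k. a (js ! i))"

(* A path of length m is the list [x_0, ..., x_m] of its positions, so it has m + 1 entries. *)
definition srw_bridges :: "nat \<Rightarrow> int list set" where
  "srw_bridges m =
     {x. length x = Suc m \<and> x ! 0 = 0 \<and>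
         (\<forall>t<m. x ! Suc t - x ! t \<in> {-1, 1}) \<and> x ! m = 0}"

definition srwb_pmf :: "nat \<Rightarrow> int list pmf" where
  "srwb_pmf n = pmf_of_set (srw_bridges (2 * n))"

definition three_srwb_pmf :: "nat \<Rightarrow> (int list \<times> int list \<times> int list) pmf" where
  "three_srwb_pmf n = pair_pmf (srwb_pmf n) (pair_pmf (srwb_pmf n) (srwb_pmf n))"

fun common_zeros :: "nat \<Rightarrow> int list \<times> int list \<times> int list \<Rightarrow> nat set" where
  "common_zeros n (x, y, z) =
     {0} \<union> {t \<in> {1..n}. x ! (2 * t) = 0 \<and> y ! (2 * t) = 0 \<and> z ! (2 * t) = 0}"

(* The summation in convolution_fold ranges over a finite set, and pmf_of_set is only
   meaningful on finite nonempty sets; the next lemmas confirm both. *)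
lemma finite_compositions: "finite {js :: nat list. length js = k \<and> sum_list js = n}"
proof (rule finite_subset)
  show "{js :: nat list. length js = k \<and> sum_list js = n} \<subseteq> {js. set js \<subseteq> {..n} \<and> length js = k}"
    using member_le_sum_list by fastforce
  show "finite {js. set js \<subseteq> {..n} \<and> length js = k}"
    by (rule finite_lists_length_eq) simp
qed

lemma finite_srw_bridges: "finite (srw_bridges m)"
proof (rule finite_subset)
  show "srw_bridges m \<subseteq> {x. set x \<subseteq> {- int m..int m} \<and> length x = Suc m}"
  proof
    fix x assume x: "x \<in> srw_bridges m"
    have bound: "t \<le> m \<Longrightarrow> \<bar>x ! t\<bar> \<le> int t" for t
    proof (induction t)
      case 0
      then show ?case using x by (simp add: srw_bridges_def)
    next
      case (Suc t)
      then have "x ! Suc t - x ! t \<in> {-1, 1}" using x by (simp add: srw_bridges_def)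
      with Suc show ?case by auto
    qed
    have "y \<in> {- int m..int m}" if "y \<in> set x" for y
    proof -
      from that x obtain t where "t \<le> m" "y = x ! t"
        by (auto simp: in_set_conv_nth srw_bridges_def less_Suc_eq_le)
      with bound[of t] show ?thesis by auto
    qed
    with x show "x \<in> {x. set x \<subseteq> {- int m..int m} \<and> length x = Suc m}"
      by (auto simp: srw_bridges_def)
  qed
  show "finite {x. set x \<subseteq> {- int m..int m} \<and> length x = Suc m}"
    by (rule finite_lists_length_eq) simp
qed

lemma srw_bridges_nonempty: "srw_bridges (2 * n) \<noteq> {}"
proof -
  have "map (\<lambda>t. int (t mod 2)) [0..<Suc (2 * n)] \<in> srw_bridges (2 * n)"
    by (auto simp: srw_bridges_def nth_append mod_Suc simp del: upt_Suc)
  then show ?thesis by blast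
qed

end

theory Submission
  imports Defs "HOL-Real_Asymp.Real_Asymp"
begin

text \<open>
  Write \<open>w n = (binom(2n, n) / 4^n)^3\<close>, so \<open>w n ~ (\<pi> n)^(-3/2)\<close> by Wallis' product, and let \<open>A\<close> be the
  sum of \<open>w\<close>. In a convolution of two sequences comparable to \<open>w\<close> only the terms near the two ends
  matter, which gives the asymptotics of all convolution powers. Cutting a triple of bridges at its
  first common zero shows \<open>w = \<delta> + u * w\<close>, where \<open>u n\<close> is the normalised number of triples with no
  common zero strictly between the ends, and that the normalised number of triples with \<open>k\<close> common
  zeros is the \<open>(k - 1)\<close>-fold convolution of \<open>u\<close>. Hence \<open>u\<close> sums to \<open>1 - 1 / A\<close>, and since \<open>A < 2\<close> a
  contraction argument yields \<open>u n / w n \<longlonglongrightarrow> 1 / A^2\<close>.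

  By Clausen's identity \<open>A\<close> is the square of the hypergeometric value \<open>F(1/4, 1/4; 1; 1)\<close>, which
  Gauss' summation evaluates to \<open>sqrt \<pi> / \<Gamma>(3/4)^2\<close>. Both identities are proved by telescoping.
\<close>

section \<open>Convolutions of sequences with regularly varying weights\<close>

text \<open>\<open>ratio\<close> makes the weights insensitive to bounded shifts of the index, and
  \<open>dom\<close> bounds \<open>w m\<close> by a multiple of \<open>w n\<close> for every
  \<open>m\<close> in the upper half of \<open>{..n}\<close>. Together they allow dominated
  convergence for convolution sums divided by \<open>w n\<close>.\<close>

locale regular_weight =
  fixes w :: "nat \<Rightarrow> real" and C :: real
  assumes pos: "w n > 0"
    and summable: "summable w"
    and ratio: "(\<lambda>n. w n / w (Suc n)) \<longlonglongrightarrow> 1"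
    and dom: "m \<le> n \<Longrightarrow> n \<le> 2 * m \<Longrightarrow> w m \<le> C * w n"
begin

lemma shift_ratio: "(\<lambda>n. w (n - i) / w n) \<longlonglongrightarrow> 1"
proof (induction i)
  case 0
  show ?case using pos by (simp add: less_imp_neq[symmetric])
next
  case (Suc i)
  have "filterlim (\<lambda>n. n - Suc i) sequentially sequentially"
    by (rule filterlim_minus_const_nat_at_top)
  from filterlim_compose[OF ratio this]
  have "(\<lambda>n. w (n - Suc i) / w (Suc (n - Suc i)) * (w (n - i) / w n)) \<longlonglongrightarrow> 1 * 1"
    by (intro tendsto_mult Suc)
  moreover have "\<forall>\<^sub>F n in sequentially.
      w (n - Suc i) / w (Suc (n - Suc i)) * (w (n - i) / w n) = w (n - Suc i) / w n"
    using eventually_gt_at_top[of i]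
  proof eventually_elim
    case (elim n)
    then have "Suc (n - Suc i) = n - i" by simp
    then show ?case using pos[of "n - i"] by simp
  qed
  ultimately show ?case using Lim_transform_eventually by fastforce
qed

text \<open>In the range \<open>2 * j + e \<le> n\<close> the index \<open>n - j\<close> is at least
  \<open>n / 2\<close>, so \<open>dom\<close> bounds the \<open>j\<close>-th quotient by
  \<open>norm (f j) * (K * C)\<close>; for fixed \<open>j\<close> that quotient tends to
  \<open>f j * \<beta>\<close>. The offset \<open>e\<close> is 0 or 1 below and decides which half
  of a split sum receives the middle index.\<close>

lemma half_convolution:
  assumes f: "summable (\<lambda>j. norm (f j :: real))" and g: "(\<lambda>n. g n / w n) \<longlonglongrightarrow> \<beta>"
  shows "(\<lambda>n. (\<Sum>j | 2 * j + e \<le> n. f j * g (n - j)) / w n) \<longlonglongrightarrow> suminf f * \<beta>"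
proof -
  obtain K where K: "K > 0" "\<And>n. norm (g n / w n) \<le> K"
    using convergent_imp_Bseq[OF convergentI[OF g]] by (auto simp: Bseq_def)
  have gK: "\<bar>g n\<bar> \<le> K * w n" for n
    using K(2)[of n] pos[of n] by (simp add: field_simps)
  define t where "t = (\<lambda>j n. if 2 * j + e \<le> n then f j * g (n - j) / w n else 0)"
  have lim: "(\<lambda>n. t j n) \<longlonglongrightarrow> f j * \<beta>" for j
  proof -
    have "(\<lambda>n. g (n - j) / w (n - j)) \<longlonglongrightarrow> \<beta>"
      by (rule filterlim_compose[OF g filterlim_minus_const_nat_at_top])
    then have "(\<lambda>n. f j * (g (n - j) / w (n - j) * (w (n - j) / w n))) \<longlonglongrightarrow> f j * (\<beta> * 1)"
      by (intro tendsto_intros shift_ratio)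
    moreover have "\<forall>\<^sub>F n in sequentially.
        f j * (g (n - j) / w (n - j) * (w (n - j) / w n)) = t j n"
      using eventually_ge_at_top[of "2 * j + e"]
    proof eventually_elim
      case (elim n)
      then show ?case using pos[of "n - j"] by (simp add: t_def)
    qed
    ultimately show ?thesis using Lim_transform_eventually by fastforce
  qed
  have bound: "norm (t j n) \<le> norm (f j) * (K * C)" for j n
  proof (cases "2 * j + e \<le> n")
    case True
    have "\<bar>g (n - j)\<bar> \<le> K * (C * w n)"
      by (rule order.trans[OF gK mult_left_mono[OF dom]]) (use True K(1) in auto)
    then have "\<bar>g (n - j)\<bar> / w n \<le> K * C" using pos[of n] by (simp add: field_simps)
    then have "\<bar>f j\<bar> * (\<bar>g (n - j)\<bar> / w n) \<le> \<bar>f j\<bar> * (K * C)"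
      by (rule mult_left_mono) simp
    then show ?thesis using True pos[of n] by (simp add: t_def abs_mult)
  next
    case False
    have "0 < C * w 0" using dom[of 0 0] pos[of 0] by simp
    then have "0 < C" using pos[of 0] by (simp add: zero_less_mult_iff)
    then show ?thesis using False K(1) by (simp add: t_def)
  qed
  have "(\<lambda>n. suminf (\<lambda>j. t j n)) \<longlonglongrightarrow> (\<Sum>j. f j * \<beta>)"
    by (rule tannerys_theorem[where M = "\<lambda>j. norm (f j) * (K * C)", THEN conjunct2, THEN conjunct2])
       (use lim bound f in \<open>auto intro!: summable_mult2 always_eventually\<close>)
  moreover have "suminf (\<lambda>j. t j n) = (\<Sum>j | 2 * j + e \<le> n. f j * g (n - j)) / w n" for n
  proof -
    have "finite {j. 2 * j + e \<le> n}" by (rule finite_subset[of _ "{..n}"]) auto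
    then have "suminf (\<lambda>j. t j n) = (\<Sum>j | 2 * j + e \<le> n. t j n)"
      by (intro suminf_finite) (auto simp: t_def)
    also have "\<dots> = (\<Sum>j | 2 * j + e \<le> n. f j * g (n - j)) / w n"
      by (simp add: t_def sum_divide_distrib)
    finally show ?thesis .
  qed
  ultimately show ?thesis
    using suminf_mult2[OF summable_norm_cancel[OF f]] by simp
qed

text \<open>Reflecting \<open>j\<close> to \<open>i = n - j\<close> turns the upper half
  \<open>n < 2 * j\<close> into \<open>2 * i + 1 \<le> n\<close>; the middle index of an even
  \<open>n\<close> stays in the first sum. The summand \<open>+ 0\<close> keeps both sums in the
  form of \<open>half_convolution\<close>.\<close>

lemma split_convolution:
  fixes f g :: "nat \<Rightarrow> real"
  shows "(\<Sum>j\<le>n. f j * g (n - j)) =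
    (\<Sum>j | 2 * j + 0 \<le> n. f j * g (n - j)) + (\<Sum>i | 2 * i + 1 \<le> n. g i * f (n - i))"
proof -
  have "(\<Sum>j\<le>n. f j * g (n - j)) =
      (\<Sum>j | 2 * j + 0 \<le> n. f j * g (n - j)) + (\<Sum>j | j \<le> n \<and> n < 2 * j. f j * g (n - j))"
    by (subst sum.union_disjoint[symmetric])
       (auto intro!: sum.cong finite_subset[of _ "{..n}"])
  also have "(\<Sum>j | j \<le> n \<and> n < 2 * j. f j * g (n - j)) = (\<Sum>i | 2 * i + 1 \<le> n. g i * f (n - i))"
    by (rule sum.reindex_bij_witness[of _ "\<lambda>i. n - i" "\<lambda>j. n - j"]) auto
  finally show ?thesis .
qed

text \<open>In each half one factor has a small index and is summed out, while the other has an
  index of order \<open>n\<close> and is compared with \<open>w\<close>.\<close>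

lemma convolution_limit:
  assumes "summable (\<lambda>j. norm (f j :: real))" "(\<lambda>n. f n / w n) \<longlonglongrightarrow> \<alpha>"
    and "summable (\<lambda>j. norm (g j :: real))" "(\<lambda>n. g n / w n) \<longlonglongrightarrow> \<beta>"
  shows "(\<lambda>n. (\<Sum>j\<le>n. f j * g (n - j)) / w n) \<longlonglongrightarrow> suminf f * \<beta> + suminf g * \<alpha>"
  unfolding split_convolution add_divide_distrib
  by (intro tendsto_add half_convolution assms)

text \<open>The limit is \<open>\<alpha>\<close> times the derivative of \<open>x ^ k\<close> at the
  sum of \<open>F\<close>: one of the \<open>k\<close> factors carries an index near
  \<open>n\<close>, the others are summed out. Absolute summability and the value of the sum are
  carried along because \<open>convolution_limit\<close> consumes them in the induction
  step.\<close>

lemma power_limit: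
  fixes F :: "real fps"
  assumes F: "summable (\<lambda>n. norm (fps_nth F n))" "(\<lambda>n. fps_nth F n / w n) \<longlonglongrightarrow> \<alpha>"
  shows "summable (\<lambda>n. norm (fps_nth (F ^ k) n)) \<and> suminf (fps_nth (F ^ k)) = suminf (fps_nth F) ^ k \<and>
    (\<lambda>n. fps_nth (F ^ k) n / w n) \<longlonglongrightarrow> of_nat k * suminf (fps_nth F) ^ (k - 1) * \<alpha>"
proof (induction k)
  case 0
  have "fps_nth (1 :: real fps) sums 1"
    using sums_finite[of "{0}" "fps_nth (1 :: real fps)"] by simp
  moreover have "summable (\<lambda>n. norm (fps_nth (1 :: real fps) n))"
    by (rule summable_finite[of "{0}"]) auto
  moreover have "(\<lambda>n. fps_nth (1 :: real fps) n / w n) \<longlonglongrightarrow> 0"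
    by (rule tendsto_eventually) (use eventually_gt_at_top[of 0] in \<open>eventually_elim, simp\<close>)
  ultimately show ?case by (simp add: sums_iff del: fps_one_nth)
next
  case (Suc k)
  let ?S = "suminf (fps_nth F)"
  have nth: "fps_nth (F ^ Suc k) n = (\<Sum>j\<le>n. fps_nth F j * fps_nth (F ^ k) (n - j))" for n
    by (simp add: fps_mult_nth atLeast0AtMost)
  have sums: "fps_nth (F ^ Suc k) sums (?S ^ Suc k)"
    unfolding nth using Cauchy_product_sums[OF F(1), of "fps_nth (F ^ k)"] Suc by simp
  have summ: "summable (\<lambda>n. norm (fps_nth (F ^ Suc k) n))"
  proof (rule summable_comparison_test')
    show "summable (\<lambda>n. \<Sum>j\<le>n. norm (fps_nth F j) * norm (fps_nth (F ^ k) (n - j)))"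
      using F(1) Suc by (intro summable_Cauchy_product) auto
    show "norm (norm (fps_nth (F ^ Suc k) n)) \<le> (\<Sum>j\<le>n. norm (fps_nth F j) * norm (fps_nth (F ^ k) (n - j)))"
      for n unfolding nth by (auto simp: abs_mult[symmetric])
  qed
  have lim: "(\<lambda>n. fps_nth (F ^ Suc k) n / w n) \<longlonglongrightarrow> ?S * (of_nat k * ?S ^ (k - 1) * \<alpha>) + ?S ^ k * \<alpha>"
    unfolding nth using convolution_limit[OF F, of "fps_nth (F ^ k)"] Suc by auto
  have "?S * (of_nat k * ?S ^ (k - 1) * \<alpha>) + ?S ^ k * \<alpha> = of_nat (Suc k) * ?S ^ (Suc k - 1) * \<alpha>"
    \<comment> \<open>For \<open>k = 0\<close> the subtraction \<open>k - 1\<close> truncates, but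
      the factor \<open>of_nat k\<close> is then 0.\<close>
    by (cases k) (simp_all add: algebra_simps)
  with sums summ lim show ?case by (simp add: sums_iff)
qed

text \<open>As power series \<open>u = 1 - 1 / w\<close>, so with \<open>A = suminf w\<close> the
  sum is \<open>1 - 1 / A\<close> and the limit is the derivative of \<open>1 - 1 / x\<close> at
  \<open>x = A\<close>. The assumption \<open>small\<close> makes the recursion for the error a
  contraction.\<close>

lemma renewal_limit:
  fixes u :: "nat \<Rightarrow> real"
  assumes u: "\<And>n. 0 \<le> u n" and u0: "u 0 = 0" and w0: "w 0 = 1"
    and renewal: "\<And>n. n > 0 \<Longrightarrow> w n = (\<Sum>j\<le>n. u j * w (n - j))"
    and small: "suminf w < 2"
  shows "summable u" "suminf u = 1 - 1 / suminf w" "(\<lambda>n. u n / w n) \<longlonglongrightarrow> 1 / (suminf w)\<^sup>2"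
proof -
  let ?A = "suminf w"
  have w_nonneg: "0 \<le> w n" for n using pos[of n] by simp
  have A_pos: "0 < ?A" using suminf_pos[OF summable] pos by simp
  have uw: "u n \<le> w n" for n
  proof (cases "n = 0")
    case False
    have "u n * w 0 \<le> (\<Sum>j\<le>n. u j * w (n - j))"
      using member_le_sum[of n "{..n}" "\<lambda>j. u j * w (n - j)"] u w_nonneg by simp
    then show ?thesis using renewal[of n] False w0 by simp
  qed (use u0 w0 in simp)
  show summ_u: "summable u"
    by (rule summable_comparison_test'[OF summable]) (use u uw in auto)
  have norm_u: "summable (\<lambda>n. norm (u n))" using summ_u u by simp
  have norm_w: "summable (\<lambda>n. norm (w n))" using summable w_nonneg by simp
  have "(\<lambda>n. \<Sum>j\<le>n. u j * w (n - j)) sums (suminf u * ?A)"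
    by (rule Cauchy_product_sums[OF norm_u norm_w])
  \<comment> \<open>The unit sequence supplies the value \<open>w 0 = 1\<close>, since the renewal
    equation is assumed only for positive indices.\<close>
  from sums_add[OF this sums_single[of 0 "\<lambda>_. 1 :: real"]]
  moreover have "(\<Sum>j\<le>n. u j * w (n - j)) + (if n = 0 then 1 else 0) = w n" for n
    using renewal[of n] w0 u0 by (cases "n = 0") auto
  ultimately have "w sums (suminf u * ?A + 1)" by simp
  then have "?A = suminf u * ?A + 1" by (simp add: sums_iff)
  then show U: "suminf u = 1 - 1 / ?A" using A_pos by (simp add: field_simps)
  txt \<open>
    The error \<open>e\<close> satisfies \<open>e n = d n - (weighted sum of earlier errors)\<close> with \<open>d \<longlonglongrightarrow> 0\<close> and weights of
    total mass tending to \<open>A - 1 < 1\<close>.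
  \<close>
  define e where "e n = u n / w n - 1 / ?A\<^sup>2" for n
  have ww: "(\<lambda>n. w n / w n) \<longlonglongrightarrow> 1" using pos by (simp add: less_imp_neq[symmetric])
  note half_u = half_convolution[OF norm_u ww, of 0]
  note half_w = half_convolution[OF norm_w ww, of 1]
  \<comment> \<open>Split the renewal equation in the middle and replace \<open>u\<close> by
    \<open>w / A^2\<close> in the half where its index is large: \<open>d n\<close> is the relative
    defect. It tends to \<open>1 - (1 - 1 / A) - 1 / A = 0\<close>.\<close>
  define d where "d n = 1 - (\<Sum>j | 2 * j + 0 \<le> n. u j * w (n - j)) / w n
    - (\<Sum>i | 2 * i + 1 \<le> n. w i * w (n - i)) / w n / ?A\<^sup>2" for n
  have "d \<longlonglongrightarrow> 1 - suminf u * 1 - ?A * 1 / ?A\<^sup>2"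
    unfolding d_def
    by (intro tendsto_diff tendsto_const half_u)
       (rule tendsto_divide[OF half_w tendsto_const], use A_pos in simp)
  then have d0: "d \<longlonglongrightarrow> 0" unfolding U using A_pos by (simp add: power2_eq_square)
  have fin: "finite {i. 2 * i + 1 \<le> n}" for n :: nat
    by (rule finite_subset[of _ "{..n}"]) auto
  have d_eq: "d n = (\<Sum>i | 2 * i + 1 \<le> n. w i * w (n - i) * e (n - i)) / w n" if "n > 0" for n
  proof -
    have "(\<Sum>i | 2 * i + 1 \<le> n. w i * w (n - i) * e (n - i))
        = (\<Sum>i | 2 * i + 1 \<le> n. w i * u (n - i)) - (\<Sum>i | 2 * i + 1 \<le> n. w i * w (n - i)) / ?A\<^sup>2"
      unfolding sum_subtractf[symmetric] sum_divide_distrib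
    proof (rule sum.cong[OF refl])
      fix i
      have "w (n - i) \<noteq> 0" using pos[of "n - i"] by simp
      then show "w i * w (n - i) * e (n - i) = w i * u (n - i) - w i * w (n - i) / ?A\<^sup>2"
        by (simp add: e_def field_simps)
    qed
    then have "(\<Sum>i | 2 * i + 1 \<le> n. w i * w (n - i) * e (n - i))
        = w n - (\<Sum>j | 2 * j + 0 \<le> n. u j * w (n - j)) - (\<Sum>i | 2 * i + 1 \<le> n. w i * w (n - i)) / ?A\<^sup>2"
      using renewal[OF that] split_convolution[of u w n] by simp
    then show ?thesis using pos[of n] by (simp add: d_def diff_divide_distrib)
  qed
  \<comment> \<open>For \<open>n > 0\<close> the subtracted 1 is the \<open>i = 0\<close> term, as
    \<open>w 0 = 1\<close>. What remains is the total weight of the earlier errors.\<close>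
  define s where "s n = (\<Sum>i | 2 * i + 1 \<le> n. w i * w (n - i)) / w n - 1" for n
  have "s \<longlonglongrightarrow> ?A * 1 - 1" unfolding s_def by (intro tendsto_diff half_w tendsto_const)
  then have s_lim: "s \<longlonglongrightarrow> ?A - 1" by simp
  \<comment> \<open>Isolating \<open>i = 0\<close> leaves \<open>e n\<close> itself. All other
    indices satisfy \<open>n < 2 * (n - i)\<close>, so only errors beyond \<open>n / 2\<close> must
    be bounded, and a bound that holds eventually can be fed back.\<close>
  have e_bound: "\<bar>e n\<bar> \<le> \<bar>d n\<bar> + M * s n"
    if "n > 0" and M: "\<And>m. n < 2 * m \<Longrightarrow> \<bar>e m\<bar> \<le> M" for n M
  proof -
    let ?I = "{i. 2 * i + 1 \<le> n} - {0}"
    have split: "(\<Sum>i | 2 * i + 1 \<le> n. h i) = h 0 + sum h ?I" for h :: "nat \<Rightarrow> real"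
      using sum.remove[OF fin, of 0 n h] that(1) by simp
    have abs_le: "\<bar>x\<bar> \<le> \<bar>z\<bar> + t" if "z = x + y" "\<bar>y\<bar> \<le> t" for x y z t :: real
      using that by linarith
    have "\<bar>w n * e n\<bar> \<le> \<bar>d n * w n\<bar> + (\<Sum>i\<in>?I. w i * w (n - i) * M)"
    proof (rule abs_le)
      show "d n * w n = w n * e n + (\<Sum>i\<in>?I. w i * w (n - i) * e (n - i))"
        using pos[of n] w0 unfolding d_eq[OF that(1)] split by simp
      show "\<bar>\<Sum>i\<in>?I. w i * w (n - i) * e (n - i)\<bar> \<le> (\<Sum>i\<in>?I. w i * w (n - i) * M)"
        by (rule order.trans[OF sum_abs sum_mono])
           (use w_nonneg M in \<open>auto simp: abs_mult intro!: mult_left_mono\<close>)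
    qed
    also have "(\<Sum>i\<in>?I. w i * w (n - i) * M) = M * s n * w n"
    proof -
      have eq: "(\<Sum>i\<in>?I. w i * w (n - i)) = s n * w n"
        using pos[of n] w0 unfolding s_def split by (simp add: left_diff_distrib)
      have "(\<Sum>i\<in>?I. w i * w (n - i) * M) = (\<Sum>i\<in>?I. w i * w (n - i)) * M"
        by (simp only: sum_distrib_right)
      then show ?thesis unfolding eq by (simp only: mult_ac)
    qed
    finally have "w n * \<bar>e n\<bar> \<le> w n * \<bar>d n\<bar> + w n * (M * s n)"
      using pos[of n] by (simp add: abs_mult mult.commute)
    then have "w n * \<bar>e n\<bar> \<le> w n * (\<bar>d n\<bar> + M * s n)" by (simp only: distrib_left)
    then show ?thesis using pos[of n] by (rule mult_left_le_imp_le)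
  qed
  \<comment> \<open>\<open>r\<close> is the midpoint of \<open>A - 1\<close> and 1, and
    \<open>q\<close> the midpoint of \<open>r\<close> and 1. The gap \<open>q - r\<close> will
    absorb the defect \<open>d\<close>.\<close>
  define r where "r = ?A / 2"
  have qr: "?A - 1 < r" "r < 1" "0 < r" using small A_pos by (auto simp: r_def)
  define q where "q = (1 + r) / 2"
  have q: "r < q" "q < 1" "0 < q" using qr by (auto simp: q_def)
  have E: "\<bar>e n\<bar> \<le> 1 + 1 / ?A\<^sup>2" for n
  proof -
    have "0 \<le> u n / w n" "u n / w n \<le> 1" using u[of n] uw[of n] pos[of n] by auto
    moreover have "0 \<le> 1 / ?A\<^sup>2" by simp
    ultimately show ?thesis unfolding e_def by linarith
  qed
  define M where "M k = (1 + 1 / ?A\<^sup>2) * q ^ k" for k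
  have M_pos: "0 < M k" for k using q by (simp add: M_def add_pos_nonneg)
  \<comment> \<open>Each round gains a factor \<open>q\<close>, but the threshold moves from
    \<open>N\<close> to at least \<open>2 * N\<close>; hence the bound is eventual for each fixed
    \<open>k\<close>.\<close>
  have contract: "\<forall>\<^sub>F n in sequentially. \<bar>e n\<bar> \<le> M k" for k
  proof (induction k)
    case 0
    show ?case using E by (simp add: M_def)
  next
    case (Suc k)
    then obtain N where N: "\<And>n. n \<ge> N \<Longrightarrow> \<bar>e n\<bar> \<le> M k" by (auto simp: eventually_sequentially)
    have "0 < (q - r) * M k" using q M_pos by simp
    from order_tendstoD(2)[OF tendsto_rabs_zero[OF d0] this] order_tendstoD(2)[OF s_lim qr(1)]
      eventually_ge_at_top[of "2 * N"] eventually_gt_at_top[of 0]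
    show ?case
    proof eventually_elim
      case (elim n)
      have "\<bar>e n\<bar> \<le> \<bar>d n\<bar> + M k * s n" by (rule e_bound) (use elim N in auto)
      also have "\<dots> \<le> (q - r) * M k + M k * r"
        using elim M_pos[of k] by (intro add_mono mult_left_mono) auto
      also have "\<dots> = q * M k" by (simp add: algebra_simps)
      also have "\<dots> = M (Suc k)" by (simp add: M_def)
      finally show ?case .
    qed
  qed
  have "e \<longlonglongrightarrow> 0"
  proof (rule tendstoI)
    fix x :: real assume "0 < x"
    have "M \<longlonglongrightarrow> (1 + 1 / ?A\<^sup>2) * 0"
      unfolding M_def using q by (intro tendsto_intros LIMSEQ_realpow_zero) auto
    then have "\<forall>\<^sub>F k in sequentially. M k < x" using \<open>0 < x\<close> by (intro order_tendstoD) auto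
    then obtain k where "M k < x" by (auto simp: eventually_sequentially)
    with contract[of k] show "\<forall>\<^sub>F n in sequentially. dist (e n) 0 < x"
      by (auto elim!: eventually_mono)
  qed
  then have "(\<lambda>n. e n + 1 / ?A\<^sup>2) \<longlonglongrightarrow> 0 + 1 / ?A\<^sup>2" by (intro tendsto_intros)
  then show "(\<lambda>n. u n / w n) \<longlonglongrightarrow> 1 / ?A\<^sup>2" by (simp add: e_def)
qed

end

section \<open>Central binomial coefficients\<close>

definition central_ratio :: "nat \<Rightarrow> real" where
  "central_ratio n = real ((2 * n) choose n) / 4 ^ n"

lemma central_ratio_0 [simp]: "central_ratio 0 = 1"
  by (simp add: central_ratio_def)

lemma central_ratio_pos [simp]: "central_ratio n > 0"
  by (simp add: central_ratio_def)

lemma central_ratio_Suc: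
  "central_ratio (Suc n) = central_ratio n * (2 * real n + 1) / (2 * real n + 2)"
proof -
  have "real ((2 * n) choose n) = fact (2 * n) / (fact n * fact n)"
    using binomial_fact[of n "2 * n", where 'a = real] by (simp add: mult_2)
  moreover have "real ((2 * Suc n) choose Suc n) = fact (2 * Suc n) / (fact (Suc n) * fact (Suc n))"
    using binomial_fact[of "Suc n" "2 * Suc n", where 'a = real] by (simp only: mult_2) simp
  moreover have "fact (2 * Suc n) = (2 * real n + 2) * (2 * real n + 1) * fact (2 * n)"
    by (simp add: algebra_simps)
  moreover have "fact (Suc n) = (real n + 1) * fact n" by simp
  moreover have "2 * real n + 2 = 2 * (real n + 1)" by simp
  ultimately have eq: "central_ratio (Suc n) = 2 * (real n + 1) * (2 * real n + 1) * fact (2 * n)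
        / ((real n + 1) * fact n * ((real n + 1) * fact n)) / (4 * 4 ^ n)"
      "central_ratio n = fact (2 * n) / (fact n * fact n) / 4 ^ n"
    by (simp_all only: central_ratio_def power_Suc)
  have cancel: "2 * y * z * F / (y * G * (y * G)) / (4 * P) = F / (G * G) / P * z / (2 * y)"
    if "y > 0" "G > 0" "P > 0" for y z F G P :: real
    using that by (simp add: field_simps)
  have "central_ratio (Suc n) = central_ratio n * (2 * real n + 1) / (2 * (real n + 1))"
    unfolding eq by (rule cancel) simp_all
  then show ?thesis by (simp add: distrib_left)
qed

section \<open>Explicit bounds, Wallis asymptotics and regularity of the cubes\<close>

lemma central_ratio_Suc_sq:
  "central_ratio (Suc n) ^ 2 * (2 * real n + 2) ^ 2 = central_ratio n ^ 2 * (2 * real n + 1) ^ 2"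
  by (simp add: central_ratio_Suc power_mult_distrib power_divide)

text \<open>The induction step is \<open>(2 n + 1) (2 n + 3) \<le> (2 n + 2)^2\<close>. Together
  with \<open>central_ratio_lower\<close> this confines the square to explicit bounds at every
  \<open>n\<close>, from which the domination constant is read off.\<close>

lemma central_ratio_upper: "central_ratio n ^ 2 * (2 * real n + 1) \<le> 1"
proof (induction n)
  case (Suc n)
  have "central_ratio (Suc n) ^ 2 * (2 * real (Suc n) + 1) * (2 * real n + 2) ^ 2
      = central_ratio n ^ 2 * (2 * real n + 1) * ((2 * real n + 1) * (2 * real n + 3))"
  proof -
    have "central_ratio (Suc n) ^ 2 * (2 * real (Suc n) + 1) * (2 * real n + 2) ^ 2
        = central_ratio (Suc n) ^ 2 * (2 * real n + 2) ^ 2 * (2 * real n + 3)" by simp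
    then show ?thesis unfolding central_ratio_Suc_sq by (simp add: power2_eq_square)
  qed
  also have "\<dots> \<le> 1 * (2 * real n + 2) ^ 2"
    by (rule mult_mono[OF Suc]) (simp_all add: power2_eq_square algebra_simps)
  finally show ?case by (rule mult_right_le_imp_le) simp
qed simp

text \<open>The cubic polynomials compared in the step, \<open>(4 n + 1) (2 n + 2)^2\<close> and
  \<open>(4 n + 5) (2 n + 1)^2\<close>, differ by exactly 1.\<close>

lemma central_ratio_lower: "1 \<le> central_ratio n ^ 2 * (4 * real n + 1)"
proof (induction n)
  case (Suc n)
  have "1 * ((4 * real n + 1) * (2 * real n + 2) ^ 2)
      \<le> (central_ratio n ^ 2 * (4 * real n + 1)) * ((4 * real n + 5) * (2 * real n + 1) ^ 2)"
    by (rule mult_mono[OF Suc]) (simp_all add: power2_eq_square algebra_simps less_imp_le)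
  also have "\<dots> = central_ratio (Suc n) ^ 2 * (4 * real (Suc n) + 1) * ((4 * real n + 1) * (2 * real n + 2) ^ 2)"
    using arg_cong[OF central_ratio_Suc_sq[of n], of "\<lambda>x. x * ((4 * real n + 1) * (4 * real n + 5))"]
    by (simp only: of_nat_Suc algebra_simps)
  finally show ?case by (rule mult_right_le_imp_le) simp
qed simp

text \<open>The partial Wallis product is an exact reciprocal, so the asymptotics of the square are
  inherited from \<open>wallis\<close>.\<close>

lemma central_ratio_wallis:
  "central_ratio n ^ 2 * (2 * real n + 1) * (\<Prod>k=1..n. (4 * real k ^ 2) / (4 * real k ^ 2 - 1)) = 1"
proof (induction n)
  case (Suc n)
  let ?P = "\<Prod>k=1..n. (4 * real k ^ 2) / (4 * real k ^ 2 - 1)"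
  have "4 * real (Suc n) ^ 2 - 1 = (2 * real n + 1) * (2 * real n + 3)"
    by (simp add: power2_eq_square algebra_simps)
  moreover have "4 * real (Suc n) ^ 2 = (2 * real n + 2) ^ 2"
    by (simp add: power2_eq_square algebra_simps)
  ultimately have P: "(\<Prod>k=1..Suc n. (4 * real k ^ 2) / (4 * real k ^ 2 - 1))
      = ?P * ((2 * real n + 2) ^ 2 / ((2 * real n + 1) * (2 * real n + 3)))"
    by (simp only: prod.nat_ivl_Suc' prod.cl_ivl_Suc) simp
  have "central_ratio (Suc n) ^ 2 * (2 * real (Suc n) + 1) * (?P * ((2 * real n + 2) ^ 2 / ((2 * real n + 1) * (2 * real n + 3))))
     = (central_ratio (Suc n) ^ 2 * (2 * real n + 2) ^ 2) * (2 * real n + 3) * ?P / ((2 * real n + 1) * (2 * real n + 3))"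
    by (simp add: mult_ac add_ac)
  also have "\<dots> = central_ratio n ^ 2 * (2 * real n + 1) * ?P"
    unfolding central_ratio_Suc_sq by (simp add: divide_simps power2_eq_square)
  finally show ?case by (simp only: P Suc)
qed simp

lemma central_ratio_limit: "(\<lambda>n. central_ratio n ^ 2 * (real n * pi)) \<longlonglongrightarrow> 1"
proof -
  let ?P = "\<lambda>n. \<Prod>k=1..n. (4 * real k ^ 2) / (4 * real k ^ 2 - 1)"
  have "(\<lambda>n. inverse (?P n)) \<longlonglongrightarrow> inverse (pi / 2)"
    by (intro tendsto_inverse wallis) simp
  also have "(\<lambda>n. inverse (?P n)) = (\<lambda>n. central_ratio n ^ 2 * (2 * real n + 1))"
    using central_ratio_wallis by (intro ext inverse_unique) (simp add: mult_ac)
  finally have "(\<lambda>n. central_ratio n ^ 2 * (2 * real n + 1)) \<longlonglongrightarrow> inverse (pi / 2)" .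
  moreover have "(\<lambda>n. real n * pi / (2 * real n + 1)) \<longlonglongrightarrow> pi / 2" by real_asymp
  ultimately have "(\<lambda>n. central_ratio n ^ 2 * (2 * real n + 1) * (real n * pi / (2 * real n + 1)))
      \<longlonglongrightarrow> inverse (pi / 2) * (pi / 2)" by (rule tendsto_mult)
  moreover have "2 * real n + 1 \<noteq> 0" for n by linarith
  ultimately show ?thesis by simp
qed

lemma central_ratio_cube_limit: "(\<lambda>n. central_ratio n ^ 3 * (real n * pi) powr (3 / 2)) \<longlonglongrightarrow> 1"
proof -
  have "(\<lambda>n. (central_ratio n ^ 2 * (real n * pi)) powr (3 / 2)) \<longlonglongrightarrow> 1 powr (3 / 2)"
    by (intro tendsto_powr central_ratio_limit tendsto_const) simp
  moreover have "(central_ratio n ^ 2 * (real n * pi)) powr (3 / 2)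
      = central_ratio n ^ 3 * (real n * pi) powr (3 / 2)" for n
  proof -
    have "(central_ratio n ^ 2) powr (3 / 2) = (central_ratio n powr 2) powr (3 / 2)"
      using powr_realpow[OF central_ratio_pos[of n], of 2] by simp
    also have "\<dots> = central_ratio n ^ 3"
      using powr_realpow[OF central_ratio_pos[of n], of 3] by (simp add: powr_powr)
    finally show ?thesis by (simp add: powr_mult)
  qed
  ultimately show ?thesis by simp
qed

lemma summable_central_ratio_cube: "summable (\<lambda>n. central_ratio n ^ 3)"
proof -
  \<comment> \<open>An arbitrary constant above the limit 1.\<close>
  have two: "1 < (2 :: real)" by simp
  have "\<forall>\<^sub>F n in sequentially. norm (central_ratio n ^ 3) \<le> 2 * real n powr (- 3 / 2)"
    using order_tendstoD(2)[OF central_ratio_cube_limit two] eventually_gt_at_top[of 0]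
  proof eventually_elim
    case (elim n)
    have "real n powr (3 / 2) \<le> (real n * pi) powr (3 / 2)"
      using pi_gt3 by (intro powr_mono2) (auto simp: mult_le_cancel_left1)
    then have "central_ratio n ^ 3 * real n powr (3 / 2) \<le> central_ratio n ^ 3 * (real n * pi) powr (3 / 2)"
      by (intro mult_left_mono) (simp_all add: less_imp_le)
    then have "central_ratio n ^ 3 * real n powr (3 / 2) \<le> 2" using elim by linarith
    then have "central_ratio n ^ 3 \<le> 2 / real n powr (3 / 2)"
      using elim(2) by (intro mult_imp_le_div_pos) auto
    moreover have "2 * real n powr (- 3 / 2) = 2 / real n powr (3 / 2)"
      using powr_minus_divide[of "real n" "3 / 2"] by simp
    moreover have "norm (central_ratio n ^ 3) = central_ratio n ^ 3"
      by (simp add: less_imp_le)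
    ultimately show ?case by (simp only:)
  qed
  then show ?thesis
    by (rule summable_comparison_test_ev) (rule summable_mult, simp add: summable_real_powr_iff)
qed

text \<open>From \<open>n \<le> 2 * m\<close> follows
  \<open>4 * n + 1 \<le> 4 * (2 * m + 1)\<close>, so the bounds on the squares lose a factor 4; this
  becomes 2 after the root and 8 after the cube.\<close>

lemma central_ratio_cube_dom:
  assumes "m \<le> n" "n \<le> 2 * m"
  shows "central_ratio m ^ 3 \<le> 8 * central_ratio n ^ 3"
proof -
  have "central_ratio m ^ 2 \<le> 1 / (2 * real m + 1)"
    by (rule mult_imp_le_div_pos[OF _ central_ratio_upper]) simp
  also have "\<dots> \<le> 4 * (1 / (4 * real n + 1))"
  proof -
    have "real n \<le> 2 * real m" using assms by linarith
    then have "4 * real n + 1 \<le> 4 * (2 * real m + 1)" by simp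
    then show ?thesis by (simp add: frac_le_eq divide_le_eq le_divide_eq)
  qed
  also have "1 / (4 * real n + 1) \<le> central_ratio n ^ 2"
    by (rule mult_imp_div_pos_le[OF _ central_ratio_lower]) simp
  finally have "central_ratio m ^ 2 \<le> (2 * central_ratio n) ^ 2" by (simp add: power2_eq_square)
  then have "central_ratio m \<le> 2 * central_ratio n"
    by (rule power2_le_imp_le) (simp add: less_imp_le)
  then have "central_ratio m ^ 3 \<le> (2 * central_ratio n) ^ 3"
    by (rule power_mono) (simp add: less_imp_le)
  then show ?thesis by (simp add: power_mult_distrib)
qed

lemma central_ratio_cube_ratio:
  "(\<lambda>n. central_ratio n ^ 3 / central_ratio (Suc n) ^ 3) \<longlonglongrightarrow> 1"
proof -
  have "(\<lambda>n. (2 * real n + 2) / (2 * real n + 1)) \<longlonglongrightarrow> 1" by real_asymp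
  from tendsto_power[OF this, of 3]
  have "(\<lambda>n. ((2 * real n + 2) / (2 * real n + 1)) ^ 3) \<longlonglongrightarrow> 1" by simp
  moreover have "((2 * real n + 2) / (2 * real n + 1)) ^ 3 = central_ratio n ^ 3 / central_ratio (Suc n) ^ 3" for n
  proof -
    have "2 * real n + 1 \<noteq> 0" "2 * real n + 2 \<noteq> 0" by linarith+
    moreover have "central_ratio n \<noteq> 0" using central_ratio_pos[of n] by linarith
    ultimately show ?thesis unfolding power_divide[symmetric] central_ratio_Suc by simp
  qed
  ultimately show ?thesis by simp
qed

section \<open>Clausen's identity and Gauss' summation\<close>

text \<open>The \<open>n\<close>-th term of the series 2F1(1/4, 1/4; c; z) at \<open>z = 1\<close>.
  The lower parameter \<open>c\<close> stays free because the sum at \<open>c = 1\<close> is found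
  by moving \<open>c\<close> to infinity.\<close>

definition gauss_term :: "real \<Rightarrow> nat \<Rightarrow> real" where
  "gauss_term c n = pochhammer (1 / 4) n ^ 2 / (pochhammer c n * fact n)"

lemma gauss_term_0 [simp]: "gauss_term c 0 = 1"
  by (simp add: gauss_term_def)

lemma gauss_term_pos: "c > 0 \<Longrightarrow> gauss_term c n > 0"
  unfolding gauss_term_def
  by (intro divide_pos_pos mult_pos_pos zero_less_power pochhammer_pos) auto

lemma gauss_term_Suc:
  assumes "c > 0"
  shows "(real n + 1) * (c + real n) * gauss_term c (Suc n) = (real n + 1 / 4) ^ 2 * gauss_term c n"
proof -
  have "pochhammer c n \<noteq> 0" using pochhammer_pos[OF assms, of n] by simp
  moreover have "c + real n > 0" "real n + 1 > 0" using assms by auto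
  ultimately show ?thesis
    by (simp add: gauss_term_def pochhammer_Suc power_mult_distrib divide_simps del: of_nat_Suc)
       (simp add: algebra_simps)
qed

text \<open>Shifting \<open>c\<close> changes one factor at each end of the Pochhammer symbol. With
  \<open>gauss_term_Suc\<close>, all terms of the contiguous relation become rational multiples of a
  single one.\<close>

lemma gauss_term_shift:
  assumes "c > 0"
  shows "c * gauss_term c n = (c + real n) * gauss_term (c + 1) n"
proof -
  have "pochhammer c (Suc n) = c * pochhammer (c + 1) n" by (rule pochhammer_rec)
  moreover have "pochhammer c (Suc n) = pochhammer c n * (c + real n)" by (rule pochhammer_Suc)
  ultimately have "c * pochhammer (c + 1) n = (c + real n) * pochhammer c n"
    by (simp only: mult.commute)
  moreover have "pochhammer c n > 0" "pochhammer (c + 1) n > 0"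
    using assms by (auto intro!: pochhammer_pos)
  moreover have "c * (x / (p * y)) = (c + real n) * (x / (q * y))"
    if "c * q = (c + real n) * p" "p > 0" "q > 0" for x y p q :: real
  proof -
    have "c * (x / (p * y)) = (c * q) * (x / (p * q * y))" using that(2,3) by simp
    also have "\<dots> = (c + real n) * (x / (q * y))" unfolding that(1) using that(2,3) by simp
    finally show ?thesis .
  qed
  ultimately show ?thesis unfolding gauss_term_def by blast
qed

text \<open>\<open>G\<close> is the Zeilberger certificate of the recurrence.\<close>

lemma clausen_recurrence:
  fixes f :: "nat \<Rightarrow> real"
  assumes f: "\<And>n. (real n + 1) ^ 2 * f (Suc n) = (real n + 1 / 4) ^ 2 * f n"
  shows "(real n + 1) ^ 3 * (\<Sum>j\<le>Suc n. f j * f (Suc n - j)) =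
         (real n + 1 / 2) ^ 3 * (\<Sum>j\<le>n. f j * f (n - j))"
proof -
  define G where "G j = real j ^ 2 * (2 * real j - 3 * real n - 3) * f j * f (Suc n - j)" for j
  have step: "(real n + 1) ^ 3 * (f j * f (Suc n - j)) - (real n + 1 / 2) ^ 3 * (f j * f (n - j))
      = G (Suc j) - G j" if "j \<le> n" for j
  proof -
    define m where "m = n - j"
    with that have n: "n = j + m" by simp
    have sub: "Suc n - j = Suc m" "n - j = m" "Suc n - Suc j = m" unfolding n by simp_all
    \<comment> \<open>The recurrence eliminates \<open>f (Suc j)\<close> and
      \<open>f (Suc m)\<close>. With the factors kept as opaque variables, only a polynomial
      identity in \<open>j\<close> and \<open>m\<close> is left to check.\<close>
    have combine: "16 * X * (K * A * B' - L * A * B) = 16 * X * (X' * U * A' * B - V * A * B')"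
      if "K * q - 16 * X * L = X * U * p - V * q" "16 * X * B' = q * B" "16 * X' * A' = p * A"
      for A A' B B' X X' K L U V p q :: real
    proof -
      have "16 * X * (K * A * B' - L * A * B) = K * A * (16 * X * B') - 16 * X * L * A * B"
        by (simp add: right_diff_distrib)
      also have "\<dots> = (K * q - 16 * X * L) * (A * B)"
        unfolding that(2) by (simp add: left_diff_distrib)
      also have "\<dots> = X * U * B * (16 * X' * A') - V * A * (16 * X * B')"
        unfolding that by (simp add: left_diff_distrib)
      also have "\<dots> = 16 * X * (X' * U * A' * B - V * A * B')"
        by (simp add: right_diff_distrib)
      finally show ?thesis .
    qed
    have scale: "16 * (real i + 1) ^ 2 * f (Suc i) = (4 * real i + 1) ^ 2 * f i" for i
    proof -
      have "(4 * real i + 1) ^ 2 = 16 * (real i + 1 / 4) ^ 2" by (simp add: power2_eq_square algebra_simps)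
      then show ?thesis using f[of i] by simp
    qed
    have "16 * (real m + 1) ^ 2 * ((real n + 1) ^ 3 * f j * f (Suc m) - (real n + 1 / 2) ^ 3 * f j * f m)
      = 16 * (real m + 1) ^ 2 * ((real j + 1) ^ 2 * (2 * (real j + 1) - 3 * real n - 3) * f (Suc j) * f m
        - real j ^ 2 * (2 * real j - 3 * real n - 3) * f j * f (Suc m))"
    proof (rule combine[OF _ scale scale])
      show "(real n + 1) ^ 3 * (4 * real m + 1) ^ 2 - 16 * (real m + 1) ^ 2 * (real n + 1 / 2) ^ 3
        = (real m + 1) ^ 2 * (2 * (real j + 1) - 3 * real n - 3) * (4 * real j + 1) ^ 2
          - real j ^ 2 * (2 * real j - 3 * real n - 3) * (4 * real m + 1) ^ 2"
        unfolding n of_nat_add by (simp add: power2_eq_square power3_eq_cube field_simps)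
    qed
    then have "(real n + 1) ^ 3 * f j * f (Suc m) - (real n + 1 / 2) ^ 3 * f j * f m
      = (real j + 1) ^ 2 * (2 * (real j + 1) - 3 * real n - 3) * f (Suc j) * f m
        - real j ^ 2 * (2 * real j - 3 * real n - 3) * f j * f (Suc m)"
      by (subst (asm) mult_cancel_left) simp
    then show ?thesis unfolding G_def sub by (simp add: mult.assoc add.commute)
  qed
  have "(real n + 1) ^ 3 * (\<Sum>j\<le>n. f j * f (Suc n - j)) - (real n + 1 / 2) ^ 3 * (\<Sum>j\<le>n. f j * f (n - j))
      = (\<Sum>j\<le>n. G (Suc j) - G j)"
    unfolding sum_distrib_left sum_subtractf[symmetric] by (intro sum.cong refl step) simp
  also have "\<dots> = G (Suc n)"
    by (subst sum_lessThan_telescope[where f = G, of "Suc n", unfolded lessThan_Suc_atMost]) (simp add: G_def)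
  \<comment> \<open>The telescoped value is exactly minus the term \<open>j = Suc n\<close>, which
    the sum up to \<open>n\<close> omits from the left convolution.\<close>
  also have "\<dots> = - ((real n + 1) ^ 3 * (f (Suc n) * f 0))"
    by (simp add: G_def power2_eq_square power3_eq_cube algebra_simps)
  finally show ?thesis by (simp add: distrib_left)
qed

text \<open>Both sides start at 1 and satisfy the same first-order recurrence, with factors
  \<open>(n + 1)^3\<close> and \<open>(n + 1/2)^3\<close>. It is the coefficient form of Clausen's
  formula for the square of 2F1(1/4, 1/4; 1; z).\<close>

lemma clausen_central_ratio:
  "(\<Sum>j\<le>n. gauss_term 1 j * gauss_term 1 (n - j)) = central_ratio n ^ 3"
proof (induction n)
  case (Suc n)
  have rec: "(real n + 1) ^ 2 * gauss_term 1 (Suc n) = (real n + 1 / 4) ^ 2 * gauss_term 1 n" for n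
    using gauss_term_Suc[of 1 n] by (simp add: power2_eq_square add.commute)
  have "real n + 1 \<noteq> 0" by linarith
  then have "central_ratio (Suc n) * (real n + 1) = central_ratio n * (real n + 1 / 2)"
    by (simp add: central_ratio_Suc field_simps)
  from arg_cong[OF this, of "\<lambda>x. x ^ 3"]
  have "(real n + 1) ^ 3 * central_ratio (Suc n) ^ 3 = (real n + 1 / 2) ^ 3 * central_ratio n ^ 3"
    by (simp only: power_mult_distrib mult.commute)
  also have "\<dots> = (real n + 1) ^ 3 * (\<Sum>j\<le>Suc n. gauss_term 1 j * gauss_term 1 (Suc n - j))"
    using clausen_recurrence[of "gauss_term 1" n, OF rec] Suc by simp
  finally show ?case using \<open>real n + 1 \<noteq> 0\<close> by (simp only: mult_cancel_left) simp
qed simp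

text \<open>Keep only the term \<open>j = n\<close> of the convolution, whose second factor is 1.
  Summability of the Gauss series then follows by comparison.\<close>

lemma gauss_term_le_central_ratio: "gauss_term 1 n \<le> central_ratio n ^ 3"
proof -
  have "0 \<le> gauss_term 1 j" for j using gauss_term_pos[of 1 j] by simp
  then show ?thesis
    using member_le_sum[of n "{..n}" "\<lambda>j. gauss_term 1 j * gauss_term 1 (n - j)"]
    by (simp add: clausen_central_ratio)
qed

section \<open>Gauss' summation by raising the lower parameter\<close>

lemma gauss_term_Suc_le:
  assumes "c \<ge> 1"
  shows "gauss_term c (Suc n) \<le> gauss_term 1 (Suc n) / c"
proof (induction n)
  case 0
  show ?case using assms by (simp add: gauss_term_def)
next
  case (Suc n)
  let ?x = "real (Suc n)"
  have c: "c > 0" using assms by simp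
  \<comment> \<open>The gain \<open>1 / c\<close> is already present in the base case; afterwards
    the quotient of consecutive terms only gets smaller when \<open>d = 1\<close> is replaced by
    \<open>d = c\<close>.\<close>
  have eq: "gauss_term d (Suc (Suc n)) = gauss_term d (Suc n) * ((?x + 1 / 4) ^ 2 / ((?x + 1) * (d + ?x)))"
    if "d > 0" for d
  proof -
    have "(?x + 1) * (d + ?x) \<noteq> 0" using that by (simp add: add_eq_0_iff_both_eq_0)
    then show ?thesis using gauss_term_Suc[OF that, of "Suc n"] by (simp add: field_simps)
  qed
  have "gauss_term c (Suc (Suc n)) \<le> gauss_term 1 (Suc n) / c * ((?x + 1 / 4) ^ 2 / ((?x + 1) * (1 + ?x)))"
    unfolding eq[OF c]
    by (intro mult_mono Suc divide_left_mono mult_left_mono)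
       (use assms gauss_term_pos[of 1 "Suc n"] in auto)
  also have "\<dots> = gauss_term 1 (Suc (Suc n)) / c" by (simp add: eq)
  finally show ?case .
qed

lemma gauss_term_le: "c \<ge> 1 \<Longrightarrow> gauss_term c n \<le> gauss_term 1 n"
proof (cases n)
  case (Suc m)
  assume c: "c \<ge> 1"
  have "gauss_term 1 n / c \<le> gauss_term 1 n / 1"
    by (rule divide_left_mono) (use c gauss_term_pos[of 1 n] in auto)
  then show ?thesis using gauss_term_Suc_le[OF c, of m] Suc by simp
qed simp

lemma summable_gauss_term: "c \<ge> 1 \<Longrightarrow> summable (gauss_term c)"
proof (rule summable_comparison_test'[OF summable_central_ratio_cube])
  fix n assume "c \<ge> 1"
  then show "norm (gauss_term c n) \<le> central_ratio n ^ 3"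
    using gauss_term_le[of c n] gauss_term_le_central_ratio[of n] gauss_term_pos[of c n] by simp
qed

text \<open>The majorant is \<open>n * central_ratio n ^ 2\<close>, which converges, times the null
  sequence \<open>central_ratio\<close>. The limit is the boundary term at infinity in the
  telescoping of \<open>gauss_contiguous\<close>.\<close>

lemma nat_times_gauss_term_limit:
  assumes "c \<ge> 1"
  shows "(\<lambda>n. real n * gauss_term c n) \<longlonglongrightarrow> 0"
proof (rule tendsto_sandwich)
  show "\<forall>\<^sub>F n in sequentially. 0 \<le> real n * gauss_term c n"
    using gauss_term_pos[of c] assms by (simp add: less_imp_le)
  show "\<forall>\<^sub>F n in sequentially. real n * gauss_term c n \<le> real n * central_ratio n ^ 3"
    using gauss_term_le[OF assms] gauss_term_le_central_ratio
    by (intro always_eventually allI mult_left_mono) (auto intro: order.trans)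
  have "(\<lambda>n. central_ratio n ^ 2 * (real n * pi) * inverse (real n)) \<longlonglongrightarrow> 1 * 0"
    by (intro tendsto_mult central_ratio_limit lim_inverse_n)
  then have "(\<lambda>n. sqrt (central_ratio n ^ 2 * (real n * pi) * inverse (real n) / pi)) \<longlonglongrightarrow> sqrt (1 * 0 / pi)"
    by (rule tendsto_real_sqrt[OF tendsto_divide[OF _ tendsto_const]]) simp
  moreover have "\<forall>\<^sub>F n in sequentially.
      sqrt (central_ratio n ^ 2 * (real n * pi) * inverse (real n) / pi) = central_ratio n"
    using eventually_gt_at_top[of 0] by eventually_elim (simp add: less_imp_le)
  ultimately have "central_ratio \<longlonglongrightarrow> 0"
    using Lim_transform_eventually by fastforce
  from tendsto_mult[OF tendsto_mult[OF central_ratio_limit this] tendsto_const[of "1 / pi"]]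
  show "(\<lambda>n. real n * central_ratio n ^ 3) \<longlonglongrightarrow> 0"
    by (simp add: power2_eq_square power3_eq_cube mult_ac)
qed simp

text \<open>Termwise, the two sides differ by a telescoping difference of
  \<open>c * n * gauss_term c n\<close>, which vanishes at \<open>n = 0\<close> and in the
  limit.\<close>

lemma gauss_contiguous:
  assumes "c \<ge> 1"
  shows "c * (c - 1 / 2) * suminf (gauss_term c) = (c - 1 / 4) ^ 2 * suminf (gauss_term (c + 1))"
proof -
  have c: "c > 0" using assms by simp
  have step: "c * (c - 1 / 2) * gauss_term c n - (c - 1 / 4) ^ 2 * gauss_term (c + 1) n
      = c * (real n * gauss_term c n - real (Suc n) * gauss_term c (Suc n))" for n
  proof -
    have cert: "c * (c - 1 / 2) * t - (c - 1 / 4) ^ 2 * t' = c * (x * t - (x + 1) * s)"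
      if "(x + 1) * (c + x) * s = (x + 1 / 4) ^ 2 * t" "c * t = (c + x) * t'" "c + x > 0" for x t t' s
    proof -
      have "(c + x) * (c * (c - 1 / 2) * t - (c - 1 / 4) ^ 2 * t')
        = (c + x) * (c * (c - 1 / 2) * t) - (c - 1 / 4) ^ 2 * (c * t)"
        unfolding that(2) by (simp add: algebra_simps)
      also have "\<dots> = c * ((c + x) * x * t) - c * ((x + 1 / 4) ^ 2 * t)"
        by (simp add: power2_eq_square field_simps)
      also have "\<dots> = (c + x) * (c * (x * t - (x + 1) * s))"
        unfolding that(1)[symmetric] by (simp add: algebra_simps)
      finally show ?thesis using that(3) by simp
    qed
    show ?thesis
      using cert[OF gauss_term_Suc[OF c] gauss_term_shift[OF c], of n] c by (simp add: add.commute)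
  qed
  have "(\<lambda>n. c * (c - 1 / 2) * gauss_term c n - (c - 1 / 4) ^ 2 * gauss_term (c + 1) n) sums
      (c * (real 0 * gauss_term c 0 - 0))"
    unfolding step by (intro sums_mult telescope_sums' nat_times_gauss_term_limit assms)
  moreover have "(\<lambda>n. c * (c - 1 / 2) * gauss_term c n - (c - 1 / 4) ^ 2 * gauss_term (c + 1) n) sums
      (c * (c - 1 / 2) * suminf (gauss_term c) - (c - 1 / 4) ^ 2 * suminf (gauss_term (c + 1)))"
    using assms by (intro sums_diff sums_mult summable_sums summable_gauss_term) auto
  ultimately show ?thesis using sums_unique2 by fastforce
qed

text \<open>The leading term is 1, and the rest is at most \<open>1 / c\<close> times the rest at
  \<open>c = 1\<close>. Hence the sums tend to 1 as \<open>c\<close> grows, which terminates the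
  iteration of the contiguous relation.\<close>

lemma gauss_sum_bounds:
  assumes "c \<ge> 1"
  shows "1 \<le> suminf (gauss_term c)" "suminf (gauss_term c) \<le> 1 + (suminf (gauss_term 1) - 1) / c"
proof -
  have split: "suminf (gauss_term d) = 1 + (\<Sum>n. gauss_term d (Suc n))" if "d \<ge> 1" for d
    using suminf_split_head[OF summable_gauss_term[OF that]] by simp
  have summ: "summable (\<lambda>n. gauss_term d (Suc n))" if "d \<ge> 1" for d
    using summable_gauss_term[OF that] by (simp add: summable_Suc_iff)
  have "0 \<le> (\<Sum>n. gauss_term c (Suc n))"
    by (rule suminf_nonneg[OF summ[OF assms]]) (use assms gauss_term_pos[of c] in \<open>simp add: less_imp_le\<close>)
  then show "1 \<le> suminf (gauss_term c)" using split[OF assms] by simp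
  have "(\<Sum>n. gauss_term c (Suc n)) \<le> (\<Sum>n. gauss_term 1 (Suc n) / c)"
    by (intro suminf_le gauss_term_Suc_le[OF assms] summable_divide summ[OF assms] summ) simp
  also have "\<dots> = (suminf (gauss_term 1) - 1) / c"
    using suminf_divide[OF summ[of 1]] split[of 1] by simp
  finally show "suminf (gauss_term c) \<le> 1 + (suminf (gauss_term 1) - 1) / c"
    using split[OF assms] by simp
qed

text \<open>This crude bound is enough for \<open>A < 2\<close>, as \<open>(9 / 7)^2 < 2\<close>.\<close>

lemma gauss_sum_le: "suminf (gauss_term 1) \<le> 9 / 7"
proof -
  have "8 * suminf (gauss_term 1) = 9 * suminf (gauss_term 2)"
    using gauss_contiguous[of 1] by (simp add: power2_eq_square)
  moreover have "suminf (gauss_term 2) \<le> 1 + (suminf (gauss_term 1) - 1) / 2"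
    by (rule gauss_sum_bounds) simp
  moreover have "x \<le> 9 / 7" if "8 * x = 9 * y" "y \<le> 1 + (x - 1) / 2" for x y :: real
    using that by (simp add: field_simps)
  ultimately show ?thesis by blast
qed

text \<open>Iterate the contiguous relation from \<open>c = 1\<close>: its factors
  \<open>c - 1 / 4\<close>, \<open>c\<close> and \<open>c - 1 / 2\<close> build up the Pochhammer
  symbols.\<close>

lemma gauss_sum_product:
  "suminf (gauss_term 1) = pochhammer (3 / 4) n ^ 2 / (pochhammer 1 n * pochhammer (1 / 2) n)
     * suminf (gauss_term (1 + real n))"
proof (induction n)
  case (Suc n)
  let ?S = "suminf (gauss_term (1 + real n))" and ?S' = "suminf (gauss_term (1 + real (Suc n)))"
  have "(1 + real n) * (1 / 2 + real n) * ?S = (3 / 4 + real n) ^ 2 * ?S'"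
    using gauss_contiguous[of "1 + real n"] by (simp add: add_ac)
  moreover have "1 + real n > 0" "1 / 2 + real n > 0" by linarith+
  ultimately have "?S = (3 / 4 + real n) ^ 2 * ?S' / ((1 + real n) * (1 / 2 + real n))"
    by (simp add: nonzero_eq_divide_eq mult.commute)
  then show ?case
    unfolding Suc pochhammer_Suc by (simp only: power_mult_distrib times_divide_times_eq) (simp add: mult_ac)
qed simp

lemma gauss_sum: "suminf (gauss_term 1) = sqrt pi / Gamma (3 / 4) ^ 2"
proof -
  define P where "P n = pochhammer (3 / 4 :: real) (Suc n) ^ 2 / (pochhammer 1 (Suc n) * pochhammer (1 / 2) (Suc n))" for n
  have G: "Gamma (3 / 4 :: real) \<noteq> 0"
    by (rule less_imp_neq[OF Gamma_real_pos, symmetric]) simp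
  have "(\<lambda>n. Gamma_series 1 n * Gamma_series (1 / 2) n / Gamma_series (3 / 4 :: real) n ^ 2)
      \<longlonglongrightarrow> Gamma 1 * Gamma (1 / 2) / Gamma (3 / 4) ^ 2"
    by (intro tendsto_intros Gamma_series_LIMSEQ) (use G in simp)
  moreover have "Gamma_series 1 n * Gamma_series (1 / 2) n / Gamma_series (3 / 4 :: real) n ^ 2 = P n" for n
  proof -
    \<comment> \<open>The powers of \<open>n\<close> in the three Gamma series cancel because
      \<open>1 + 1 / 2 = 2 * (3 / 4)\<close>.\<close>
    have e: "exp (ln (real n)) * exp (ln (real n) / 2) = exp (3 * ln (real n) / 4) ^ 2"
      by (simp add: exp_add[symmetric] exp_double[symmetric] field_simps)
    have "pochhammer (3 / 4 :: real) (Suc n) \<noteq> 0"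
      using pochhammer_pos[of "3 / 4 :: real" "Suc n"] by simp
    then show ?thesis using e
      by (simp add: Gamma_series_def P_def field_simps power2_eq_square)
  qed
  ultimately have P: "P \<longlonglongrightarrow> sqrt pi / Gamma (3 / 4) ^ 2" by (simp add: Gamma_one_half_real)
  have "(\<lambda>n. suminf (gauss_term (1 + real (Suc n)))) \<longlonglongrightarrow> 1"
  proof (rule tendsto_sandwich[OF _ _ tendsto_const])
    show "\<forall>\<^sub>F n in sequentially. 1 \<le> suminf (gauss_term (1 + real (Suc n)))"
      by (intro always_eventually allI gauss_sum_bounds) simp
    show "\<forall>\<^sub>F n in sequentially. suminf (gauss_term (1 + real (Suc n)))
        \<le> 1 + (suminf (gauss_term 1) - 1) / (1 + real (Suc n))"
      by (intro always_eventually allI gauss_sum_bounds) simp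
    have "(\<lambda>n. 1 / (1 + real (Suc n))) \<longlonglongrightarrow> 0" by real_asymp
    from tendsto_add[OF tendsto_const[of 1] tendsto_mult[OF tendsto_const[of "suminf (gauss_term 1) - 1"] this]]
    show "(\<lambda>n. 1 + (suminf (gauss_term 1) - 1) / (1 + real (Suc n))) \<longlonglongrightarrow> 1" by simp
  qed
  from tendsto_mult[OF P this]
  have "(\<lambda>n. suminf (gauss_term 1)) \<longlonglongrightarrow> sqrt pi / Gamma (3 / 4) ^ 2"
    unfolding P_def gauss_sum_product[symmetric] by simp
  then show ?thesis by (simp add: LIMSEQ_const_iff)
qed

lemma central_ratio_cube_sum: "(\<Sum>n. central_ratio n ^ 3) = pi / Gamma (3 / 4) ^ 4"
  and central_ratio_cube_sum_less: "(\<Sum>n. central_ratio n ^ 3) < 2"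
proof -
  have "summable (\<lambda>n. norm (gauss_term 1 n))"
    using summable_gauss_term[of 1] gauss_term_pos[of 1] by (simp add: less_imp_le)
  from Cauchy_product[OF this this]
  have eq: "(\<Sum>n. central_ratio n ^ 3) = suminf (gauss_term 1) ^ 2"
    by (simp add: clausen_central_ratio power2_eq_square)
  then show "(\<Sum>n. central_ratio n ^ 3) = pi / Gamma (3 / 4) ^ 4"
    by (simp add: gauss_sum power_divide)
  have "suminf (gauss_term 1) ^ 2 \<le> (9 / 7) ^ 2"
    using gauss_sum_le gauss_sum_bounds(1)[of 1] by (intro power_mono) auto
  also have "\<dots> < 2" by (simp add: power2_eq_square)
  finally show "(\<Sum>n. central_ratio n ^ 3) < 2" using eq by simp
qed

section \<open>Bridges and their common zeros\<close>

text \<open>A path is coded by its set of up-step times. Its height is up-steps minus down-steps, so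
  a path of length \<open>2 * n\<close> closes exactly when there are \<open>n\<close>
  up-steps.\<close>

lemma bij_betw_bridges_subsets:
  "bij_betw (\<lambda>S. map (\<lambda>t. 2 * int (card (S \<inter> {..<t})) - int t) [0..<Suc (2 * n)])
     {S. S \<subseteq> {..<2 * n} \<and> card S = n} (srw_bridges (2 * n))"
proof -
  define path where "path S = map (\<lambda>t. 2 * int (card (S \<inter> {..<t})) - int t) [0..<Suc (2 * n)]" for S
  have nth: "path S ! t = 2 * int (card (S \<inter> {..<t})) - int t" if "t \<le> 2 * n" for S t
    using that unfolding path_def by (subst nth_map) (auto simp del: upt_Suc)
  have card_Suc: "card (S \<inter> {..<Suc t}) = card (S \<inter> {..<t}) + (if t \<in> S then 1 else 0)" for S t
    by (simp add: lessThan_Suc Int_insert_right)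
  have "bij_betw path {S. S \<subseteq> {..<2 * n} \<and> card S = n} (srw_bridges (2 * n))"
  proof (rule bij_betw_byWitness[where f' = "\<lambda>x. {t. t < 2 * n \<and> x ! t < x ! Suc t}"])
    show "\<forall>S\<in>{S. S \<subseteq> {..<2 * n} \<and> card S = n}. {t. t < 2 * n \<and> path S ! t < path S ! Suc t} = S"
      by (auto simp: nth card_Suc split: if_splits)
    have heights: "2 * int (card ({s. s < 2 * n \<and> x ! s < x ! Suc s} \<inter> {..<t})) - int t = x ! t"
      if x: "x \<in> srw_bridges (2 * n)" and "t \<le> 2 * n" for x t
      using that(2)
    proof (induction t)
      case 0
      then show ?case using x by (simp add: srw_bridges_def)
    next
      case (Suc t)
      then have "x ! Suc t - x ! t \<in> {-1, 1}" using x by (simp add: srw_bridges_def)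
      with Suc show ?case by (auto simp: card_Suc)
    qed
    show "\<forall>x\<in>srw_bridges (2 * n). path {t. t < 2 * n \<and> x ! t < x ! Suc t} = x"
    proof
      fix x assume x: "x \<in> srw_bridges (2 * n)"
      show "path {t. t < 2 * n \<and> x ! t < x ! Suc t} = x"
      proof (rule nth_equalityI)
        show len: "length (path {t. t < 2 * n \<and> x ! t < x ! Suc t}) = length x"
          using x by (simp add: path_def srw_bridges_def)
        fix t assume "t < length (path {t. t < 2 * n \<and> x ! t < x ! Suc t})"
        then have "t \<le> 2 * n" by (simp add: path_def)
        then show "path {t. t < 2 * n \<and> x ! t < x ! Suc t} ! t = x ! t"
          by (simp only: nth heights[OF x])
      qed
    qed
    show "path ` {S. S \<subseteq> {..<2 * n} \<and> card S = n} \<subseteq> srw_bridges (2 * n)"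
    proof (rule image_subsetI)
      fix S assume "S \<in> {S. S \<subseteq> {..<2 * n} \<and> card S = n}"
      then have S: "S \<inter> {..<2 * n} = S" "card S = n" by auto
      have "path S ! (2 * n) = 0" using nth[of "2 * n" S] S by simp
      moreover have "path S ! Suc t - path S ! t \<in> {-1, 1}" if "t < 2 * n" for t
        using that nth[of t S] nth[of "Suc t" S] by (simp add: card_Suc)
      moreover have "path S ! 0 = 0" using nth[of 0 S] by simp
      moreover have "length (path S) = Suc (2 * n)" by (simp add: path_def)
      ultimately show "path S \<in> srw_bridges (2 * n)" unfolding srw_bridges_def by blast
    qed
    show "(\<lambda>x. {t. t < 2 * n \<and> x ! t < x ! Suc t}) ` srw_bridges (2 * n) \<subseteq> {S. S \<subseteq> {..<2 * n} \<and> card S = n}"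
    proof safe
      fix x assume x: "x \<in> srw_bridges (2 * n)"
      let ?S = "{t. t < 2 * n \<and> x ! t < x ! Suc t}"
      have "?S \<inter> {..<2 * n} = ?S" by auto
      moreover have "x ! (2 * n) = 0" using x by (simp add: srw_bridges_def)
      ultimately show "card ?S = n" using heights[OF x, of "2 * n"] by simp
    qed
  qed
  then show ?thesis unfolding path_def .
qed

lemma card_srw_bridges: "card (srw_bridges (2 * n)) = (2 * n) choose n"
  using bij_betw_same_card[OF bij_betw_bridges_subsets, of n] n_subsets[of "{..<2 * n}" n] by simp

text \<open>Both pieces contain the vertex at time \<open>2 * j\<close>, so gluing them discards the
  head of the second piece.\<close>

lemma bij_betw_split_bridge:
  assumes "j \<le> n"
  shows "bij_betw (\<lambda>x. (take (Suc (2 * j)) x, drop (2 * j) x))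
    {x \<in> srw_bridges (2 * n). x ! (2 * j) = 0} (srw_bridges (2 * j) \<times> srw_bridges (2 * (n - j)))"
proof -
  have nth_join: "(y @ tl z) ! t = (if t \<le> 2 * j then y ! t else z ! (t - 2 * j))"
    if y: "y \<in> srw_bridges (2 * j)" and z: "z \<in> srw_bridges (2 * (n - j))" and "t \<le> 2 * n" for y z t
  proof -
    have len: "length y = Suc (2 * j)" using y by (simp add: srw_bridges_def)
    have z0: "z ! Suc i = tl z ! i" for i using z by (cases z) (simp_all add: srw_bridges_def)
    show ?thesis
    proof (cases "t \<le> 2 * j")
      case False
      then have "t - 2 * j = Suc (t - Suc (2 * j))" by simp
      then show ?thesis using False len by (simp add: nth_append z0)
    qed (simp add: nth_append len)
  qed
  have join: "y @ tl z \<in> srw_bridges (2 * n)"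
    if y: "y \<in> srw_bridges (2 * j)" and z: "z \<in> srw_bridges (2 * (n - j))" for y z
  proof -
    have ends: "y ! (2 * j) = 0" "z ! 0 = 0" "y ! 0 = 0" "z ! (2 * (n - j)) = 0"
      using y z by (auto simp: srw_bridges_def)
    have "(y @ tl z) ! Suc t - (y @ tl z) ! t \<in> {-1, 1}" if t: "t < 2 * n" for t
    proof (cases "t < 2 * j")
      case True
      then show ?thesis using y t by (simp add: nth_join[OF y z] srw_bridges_def)
    next
      case False
      then have "(y @ tl z) ! Suc t = z ! Suc (t - 2 * j)" "(y @ tl z) ! t = z ! (t - 2 * j)"
        using t ends by (auto simp: nth_join[OF y z] Suc_diff_le)
      moreover have "t - 2 * j < 2 * (n - j)" using False t assms by linarith
      ultimately show ?thesis using z by (simp add: srw_bridges_def)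
    qed
    moreover have "(y @ tl z) ! 0 = 0" "(y @ tl z) ! (2 * n) = 0"
      using ends assms by (auto simp: nth_join[OF y z] diff_mult_distrib2)
    moreover have "length (y @ tl z) = Suc (2 * n)" using y z assms by (simp add: srw_bridges_def)
    ultimately show ?thesis by (simp add: srw_bridges_def)
  qed
  show ?thesis
  proof (rule bij_betw_byWitness[where f' = "\<lambda>(y, z). y @ tl z"])
    show "\<forall>x\<in>{x \<in> srw_bridges (2 * n). x ! (2 * j) = 0}.
        (case (take (Suc (2 * j)) x, drop (2 * j) x) of (y, z) \<Rightarrow> y @ tl z) = x"
      by (auto simp: tl_drop drop_Suc[symmetric])
    show "\<forall>w\<in>srw_bridges (2 * j) \<times> srw_bridges (2 * (n - j)).
        (take (Suc (2 * j)) (case w of (y, z) \<Rightarrow> y @ tl z), drop (2 * j) (case w of (y, z) \<Rightarrow> y @ tl z)) = w"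
    proof
      fix w assume "w \<in> srw_bridges (2 * j) \<times> srw_bridges (2 * (n - j))"
      then obtain y z where w: "w = (y, z)"
        and y: "y \<in> srw_bridges (2 * j)" and z: "z \<in> srw_bridges (2 * (n - j))" by blast
      have "drop (2 * j) y = [y ! (2 * j)]"
        using y by (subst Cons_nth_drop_Suc[symmetric]) (auto simp: srw_bridges_def)
      moreover have "z = 0 # tl z" using z by (cases z) (auto simp: srw_bridges_def)
      ultimately have "(take (Suc (2 * j)) (y @ tl z), drop (2 * j) (y @ tl z)) = (y, z)"
        using y by (auto simp: srw_bridges_def)
      then show "(take (Suc (2 * j)) (case w of (y, z) \<Rightarrow> y @ tl z),
          drop (2 * j) (case w of (y, z) \<Rightarrow> y @ tl z)) = w" by (simp add: w)
    qed
    show "(\<lambda>x. (take (Suc (2 * j)) x, drop (2 * j) x)) ` {x \<in> srw_bridges (2 * n). x ! (2 * j) = 0}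
        \<subseteq> srw_bridges (2 * j) \<times> srw_bridges (2 * (n - j))"
    proof (rule image_subsetI)
      fix x assume "x \<in> {x \<in> srw_bridges (2 * n). x ! (2 * j) = 0}"
      then have len: "length x = Suc (2 * n)"
        and zeros: "x ! 0 = 0" "x ! (2 * j) = 0" "x ! (2 * n) = 0"
        and step: "\<And>t. t < 2 * n \<Longrightarrow> x ! Suc t - x ! t \<in> {-1, 1}"
        by (simp_all add: srw_bridges_def)
      have "take (Suc (2 * j)) x ! Suc t - take (Suc (2 * j)) x ! t \<in> {-1, 1}" if "t < 2 * j" for t
        using step[of t] that assms by simp
      then have "take (Suc (2 * j)) x \<in> srw_bridges (2 * j)"
        using len zeros assms by (simp add: srw_bridges_def)
      moreover have "drop (2 * j) x ! Suc t - drop (2 * j) x ! t \<in> {-1, 1}" if "t < 2 * (n - j)" for t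
        using step[of "2 * j + t"] that assms len by simp
      moreover have "drop (2 * j) x ! (2 * (n - j)) = 0"
      proof -
        have "2 * j + 2 * (n - j) = 2 * n" using assms by simp
        then show ?thesis using len zeros assms by simp
      qed
      ultimately show "(take (Suc (2 * j)) x, drop (2 * j) x)
          \<in> srw_bridges (2 * j) \<times> srw_bridges (2 * (n - j))"
        using len zeros assms by (simp add: srw_bridges_def)
    qed
    show "(\<lambda>(y, z). y @ tl z) ` (srw_bridges (2 * j) \<times> srw_bridges (2 * (n - j)))
        \<subseteq> {x \<in> srw_bridges (2 * n). x ! (2 * j) = 0}"
    proof (rule image_subsetI)
      fix w assume "w \<in> srw_bridges (2 * j) \<times> srw_bridges (2 * (n - j))"
      then obtain y z where w: "w = (y, z)"
        and y: "y \<in> srw_bridges (2 * j)" and z: "z \<in> srw_bridges (2 * (n - j))" by blast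
      have "y ! (2 * j) = 0" using y by (simp add: srw_bridges_def)
      then show "(case w of (y, z) \<Rightarrow> y @ tl z) \<in> {x \<in> srw_bridges (2 * n). x ! (2 * j) = 0}"
        using join[OF y z] nth_join[OF y z] assms by (simp add: w)
    qed
  qed
qed

section \<open>Triples of bridges cut at a common zero\<close>

lemma pair_pmf_of_set:
  assumes "finite A" "A \<noteq> {}" "finite B" "B \<noteq> {}"
  shows "pair_pmf (pmf_of_set A) (pmf_of_set B) = pmf_of_set (A \<times> B)"
proof (rule pmf_eqI)
  fix p
  show "pmf (pair_pmf (pmf_of_set A) (pmf_of_set B)) p = pmf (pmf_of_set (A \<times> B)) p"
    using assms by (cases p) (simp add: pmf_pair indicator_def)
qed

definition bridge_triples :: "nat \<Rightarrow> (int list \<times> int list \<times> int list) set" where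
  "bridge_triples n = srw_bridges (2 * n) \<times> srw_bridges (2 * n) \<times> srw_bridges (2 * n)"

lemma finite_bridge_triples: "finite (bridge_triples n)"
  by (simp add: bridge_triples_def finite_srw_bridges)

lemma bridge_triples_nonempty: "bridge_triples n \<noteq> {}"
  by (simp add: bridge_triples_def srw_bridges_nonempty)

lemma card_bridge_triples: "card (bridge_triples n) = ((2 * n) choose n) ^ 3"
  by (simp add: bridge_triples_def card_cartesian_product card_srw_bridges power3_eq_cube)

lemma three_srwb_pmf_eq: "three_srwb_pmf n = pmf_of_set (bridge_triples n)"
  unfolding three_srwb_pmf_def srwb_pmf_def bridge_triples_def
  by (simp add: pair_pmf_of_set finite_srw_bridges srw_bridges_nonempty)

lemma bij_betw_triple:
  assumes "bij_betw f A (B \<times> C)"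
  shows "bij_betw (\<lambda>(x, y, z). ((fst (f x), fst (f y), fst (f z)), (snd (f x), snd (f y), snd (f z))))
    (A \<times> A \<times> A) ((B \<times> B \<times> B) \<times> (C \<times> C \<times> C))"
proof -
  define g where "g = inv_into A f"
  have 1: "g (f x) = x" "fst (f x) \<in> B" "snd (f x) \<in> C" if "x \<in> A" for x
  proof -
    have "f x \<in> B \<times> C" using assms that by (auto dest: bij_betwE)
    then show "g (f x) = x" "fst (f x) \<in> B" "snd (f x) \<in> C"
      using assms that by (auto simp: g_def bij_betw_inv_into_left mem_Times_iff)
  qed
  have 2: "f (g (b, c)) = (b, c)" "g (b, c) \<in> A" if "b \<in> B" "c \<in> C" for b c
    using assms that unfolding g_def
    by (auto simp: bij_betw_def intro!: f_inv_into_f inv_into_into)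
  show ?thesis
    by (rule bij_betw_byWitness[where
          f' = "\<lambda>((b1, b2, b3), (c1, c2, c3)). (g (b1, c1), g (b2, c2), g (b3, c3))"])
       (auto simp: 1 2)
qed

lemma finite_common_zeros [simp]: "finite (common_zeros n w)"
  by (cases w) simp

lemma zero_in_common_zeros [simp]: "0 \<in> common_zeros n w"
  by (cases w) simp

lemma common_zeros_le: "t \<in> common_zeros n w \<Longrightarrow> t \<le> n"
  by (cases w) auto

lemma end_in_common_zeros: "w \<in> bridge_triples n \<Longrightarrow> n \<in> common_zeros n w"
  by (cases w) (auto simp: bridge_triples_def srw_bridges_def)

text \<open>Bridges start at 0, so the time 0 inserted by hand in the definition obeys the same
  condition as the others.\<close>

lemma mem_common_zeros:
  assumes "(x, y, z) \<in> bridge_triples n"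
  shows "t \<in> common_zeros n (x, y, z) \<longleftrightarrow> t \<le> n \<and> x ! (2 * t) = 0 \<and> y ! (2 * t) = 0 \<and> z ! (2 * t) = 0"
  using assms by (cases "t = 0") (auto simp: bridge_triples_def srw_bridges_def)

declare common_zeros.simps [simp del]

definition split_triple ::
    "nat \<Rightarrow> int list \<times> int list \<times> int list \<Rightarrow> (int list \<times> int list \<times> int list) \<times> int list \<times> int list \<times> int list" where
  "split_triple j = (\<lambda>(x, y, z).
     ((take (Suc (2 * j)) x, take (Suc (2 * j)) y, take (Suc (2 * j)) z),
      (drop (2 * j) x, drop (2 * j) y, drop (2 * j) z)))"

lemma bij_betw_split_triple:
  assumes "j \<le> n"
  shows "bij_betw (split_triple j) {w \<in> bridge_triples n. j \<in> common_zeros n w}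
    (bridge_triples j \<times> bridge_triples (n - j))"
proof -
  let ?A = "{x \<in> srw_bridges (2 * n). x ! (2 * j) = 0}"
  have "{w \<in> bridge_triples n. j \<in> common_zeros n w} = ?A \<times> ?A \<times> ?A"
  proof (rule set_eqI)
    fix w :: "int list \<times> int list \<times> int list"
    obtain x y z where "w = (x, y, z)" by (cases w)
    then show "w \<in> {w \<in> bridge_triples n. j \<in> common_zeros n w} \<longleftrightarrow> w \<in> ?A \<times> ?A \<times> ?A"
      using mem_common_zeros[of x y z n j] assms by (auto simp: bridge_triples_def)
  qed
  then show ?thesis
    using bij_betw_triple[OF bij_betw_split_bridge[OF assms]]
    by (simp add: split_triple_def bridge_triples_def)
qed

text \<open>The cut point is a zero of both pieces, so both ranges are closed at \<open>j\<close>;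
  the second piece restarts its clock at the cut.\<close>

lemma common_zeros_split:
  assumes "w \<in> bridge_triples n" "j \<in> common_zeros n w" "split_triple j w = (v, v')"
  shows "common_zeros j v = common_zeros n w \<inter> {..j}"
    and "(+) j ` common_zeros (n - j) v' = common_zeros n w \<inter> {j..}"
proof -
  obtain x y z where w: "w = (x, y, z)" by (cases w)
  have j: "j \<le> n" using common_zeros_le assms(2) by blast
  have "split_triple j w \<in> bridge_triples j \<times> bridge_triples (n - j)"
    using bij_betwE[OF bij_betw_split_triple[OF j]] assms(1,2) by blast
  then have mem: "v \<in> bridge_triples j" "v' \<in> bridge_triples (n - j)" using assms(3) by auto
  have v: "v = (take (Suc (2 * j)) x, take (Suc (2 * j)) y, take (Suc (2 * j)) z)"
    "v' = (drop (2 * j) x, drop (2 * j) y, drop (2 * j) z)"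
    using assms(3) by (auto simp: split_triple_def w)
  have len: "length x = Suc (2 * n)" "length y = Suc (2 * n)" "length z = Suc (2 * n)"
    using assms(1) by (auto simp: w bridge_triples_def srw_bridges_def)
  note mem_w = mem_common_zeros[OF assms(1)[unfolded w]]
  note mem_v = mem_common_zeros[OF mem(1)[unfolded v]] mem_common_zeros[OF mem(2)[unfolded v]]
  show "common_zeros j v = common_zeros n w \<inter> {..j}"
    using j by (auto simp: v w mem_w mem_v)
  have "t + j \<in> common_zeros n w \<longleftrightarrow> t \<in> common_zeros (n - j) v'" for t
    unfolding v w mem_w mem_v using j len
    by (cases "t + j \<le> n") (auto simp: algebra_simps)
  then show "(+) j ` common_zeros (n - j) v' = common_zeros n w \<inter> {j..}"
    by (auto simp: image_iff add.commute le_iff_add)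
qed

text \<open>Since \<open>j\<close> is counted on both sides, the two parts have
  \<open>card Z + 1\<close> elements in total. A left part of size 2 is \<open>{0, j}\<close>, which
  says that \<open>j\<close> is the least positive element.\<close>

lemma card_eq_Suc_iff_first_positive:
  fixes Z :: "nat set"
  assumes "finite Z" "0 \<in> Z" "k \<ge> 1"
  shows "card Z = Suc k \<longleftrightarrow>
    (\<exists>j\<in>Z. 1 \<le> j \<and> card (Z \<inter> {..j}) = 2 \<and> card (Z \<inter> {j..}) = k)"
proof -
  have split: "Suc (card Z) = card (Z \<inter> {..j}) + card (Z \<inter> {j..})" if "j \<in> Z" for j
  proof -
    have "card ((Z \<inter> {..j}) \<union> (Z \<inter> {j..})) + card ((Z \<inter> {..j}) \<inter> (Z \<inter> {j..}))
        = card (Z \<inter> {..j}) + card (Z \<inter> {j..})"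
      using assms(1) by (intro card_Un_Int[symmetric]) auto
    moreover have "(Z \<inter> {..j}) \<union> (Z \<inter> {j..}) = Z" "(Z \<inter> {..j}) \<inter> (Z \<inter> {j..}) = {j}"
      using that by auto
    ultimately show ?thesis by simp
  qed
  show ?thesis
  proof
    assume Z: "card Z = Suc k"
    define j where "j = Min (Z - {0})"
    have "Z - {0} \<noteq> {}"
    proof
      assume "Z - {0} = {}"
      with assms(2) have "Z = {0}" by blast
      with Z assms(3) show False by simp
    qed
    then have j: "j \<in> Z - {0}" unfolding j_def using assms(1) by (intro Min_in) auto
    have min: "j \<le> t" if "t \<in> Z - {0}" for t
      unfolding j_def using assms(1) that by (intro Min_le) auto
    have "Z \<inter> {..j} = {0, j}" using j min assms(2) by force
    then have "card (Z \<inter> {..j}) = 2" using j by simp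
    with split[of j] j Z show "\<exists>j\<in>Z. 1 \<le> j \<and> card (Z \<inter> {..j}) = 2 \<and> card (Z \<inter> {j..}) = k"
      by (intro bexI[of _ j]) auto
  next
    assume "\<exists>j\<in>Z. 1 \<le> j \<and> card (Z \<inter> {..j}) = 2 \<and> card (Z \<inter> {j..}) = k"
    then obtain j where "j \<in> Z" "card (Z \<inter> {..j}) = 2" "card (Z \<inter> {j..}) = k" by blast
    with split[of j] show "card Z = Suc k" by simp
  qed
qed

text \<open>The smaller candidate would lie in the left part \<open>{0, t}\<close> of the larger
  one. This gives disjointness when triples are classified by their first positive common
  zero.\<close>

lemma first_positive_unique:
  fixes Z :: "nat set"
  assumes "0 \<in> Z" "i \<in> Z" "j \<in> Z" "1 \<le> i" "1 \<le> j"
    and "card (Z \<inter> {..i}) = 2" "card (Z \<inter> {..j}) = 2"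
  shows "i = j"
proof -
  have eq: "Z \<inter> {..t} = {0, t}" if "t \<in> Z" "1 \<le> t" "card (Z \<inter> {..t}) = 2" for t
    by (rule sym, rule card_subset_eq) (use that assms(1) in \<open>auto intro: card_ge_0_finite\<close>)
  show ?thesis
  proof (cases "i \<le> j")
    case True
    then have "i \<in> Z \<inter> {..j}" using assms by simp
    then show ?thesis using assms(4) unfolding eq[OF assms(3,5,7)] by simp
  next
    case False
    then have "j \<in> Z \<inter> {..i}" using assms by simp
    then show ?thesis using assms(5) unfolding eq[OF assms(2,4,6)] by simp
  qed
qed

section \<open>Counting triples by their number of common zeros\<close>

definition zero_count :: "nat \<Rightarrow> nat \<Rightarrow> nat" where
  "zero_count n k = card {w \<in> bridge_triples n. card (common_zeros n w) = k}"

text \<open>Cut at the first positive common zero \<open>j\<close>. As both ends always count,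
  \<open>zero_count j 2\<close> for \<open>j \<ge> 1\<close> is the number of triples with no common
  zero strictly between the ends.\<close>

lemma zero_count_Suc:
  assumes "k \<ge> 1"
  shows "zero_count n (Suc k) = (\<Sum>j = 1..n. zero_count j 2 * zero_count (n - j) k)"
proof -
  let ?Z = "common_zeros n"
  define D where "D j = {w \<in> {w \<in> bridge_triples n. j \<in> ?Z w}.
    card (?Z w \<inter> {..j}) = 2 \<and> card (?Z w \<inter> {j..}) = k}" for j
  have "{w \<in> bridge_triples n. card (?Z w) = Suc k} = (\<Union>j\<in>{1..n}. D j)"
  proof (rule set_eqI)
    fix w
    show "w \<in> {w \<in> bridge_triples n. card (?Z w) = Suc k} \<longleftrightarrow> w \<in> (\<Union>j\<in>{1..n}. D j)"
      using card_eq_Suc_iff_first_positive[OF finite_common_zeros zero_in_common_zeros assms, of n w]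
        common_zeros_le[of _ n w] by (auto simp: D_def)
  qed
  moreover have "card (\<Union>j\<in>{1..n}. D j) = (\<Sum>j = 1..n. card (D j))"
  proof (rule card_UN_disjoint)
    show "\<forall>j\<in>{1..n}. finite (D j)" by (auto simp: D_def finite_bridge_triples)
    show "\<forall>i\<in>{1..n}. \<forall>j\<in>{1..n}. i \<noteq> j \<longrightarrow> D i \<inter> D j = {}"
      unfolding D_def using first_positive_unique[OF zero_in_common_zeros] by auto
  qed simp
  moreover have "card (D j) = zero_count j 2 * zero_count (n - j) k" if "j \<in> {1..n}" for j
  proof -
    let ?Q = "\<lambda>(v, v'). card (common_zeros j v) = 2 \<and> card (common_zeros (n - j) v') = k"
    have "bij_betw (split_triple j) (D j) {q \<in> bridge_triples j \<times> bridge_triples (n - j). ?Q q}"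
      unfolding D_def
    proof (rule bij_betw_Collect)
      show "bij_betw (split_triple j) {w \<in> bridge_triples n. j \<in> ?Z w} (bridge_triples j \<times> bridge_triples (n - j))"
        using that by (intro bij_betw_split_triple) simp
      fix w assume w: "w \<in> {w \<in> bridge_triples n. j \<in> ?Z w}"
      obtain v v' where v: "split_triple j w = (v, v')" by (cases "split_triple j w")
      have "card (?Z w \<inter> {j..}) = card (common_zeros (n - j) v')"
        using w v common_zeros_split(2)[of w n j v v'] card_image[of "(+) j" "common_zeros (n - j) v'"]
        by (simp add: inj_on_def)
      then show "?Q (split_triple j w) \<longleftrightarrow> card (?Z w \<inter> {..j}) = 2 \<and> card (?Z w \<inter> {j..}) = k"
        using w v common_zeros_split(1)[of w n j v v'] by simp
    qed
    moreover have "{q \<in> bridge_triples j \<times> bridge_triples (n - j). ?Q q}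
        = {v \<in> bridge_triples j. card (common_zeros j v) = 2}
          \<times> {v \<in> bridge_triples (n - j). card (common_zeros (n - j) v) = k}" by auto
    ultimately show ?thesis
      by (simp add: bij_betw_same_card zero_count_def card_cartesian_product)
  qed
  ultimately show ?thesis by (simp add: zero_count_def)
qed

lemma zero_count_1: "zero_count n (Suc 0) = (if n = 0 then 1 else 0)"
proof (cases "n = 0")
  case True
  have "common_zeros 0 w = {0}" for w using common_zeros_le[of _ 0 w] zero_in_common_zeros[of 0 w] by blast
  then show ?thesis using True card_bridge_triples[of 0] by (simp add: zero_count_def)
next
  case False
  have "card (common_zeros n w) \<noteq> Suc 0" if "w \<in> bridge_triples n" for w
  proof
    assume "card (common_zeros n w) = Suc 0"
    then obtain a where "common_zeros n w = {a}" by (auto simp: card_Suc_eq)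
    then have "0 = a" "n = a" using zero_in_common_zeros[of n w] end_in_common_zeros[OF that] by blast+
    then show False using False by simp
  qed
  then have "{w \<in> bridge_triples n. card (common_zeros n w) = Suc 0} = {}" by blast
  then show ?thesis using False by (simp only: zero_count_def) simp
qed

text \<open>There are between 1 and \<open>n + 1\<close> common zeros. Leaving \<open>K\<close> free
  lets one range of \<open>k\<close> serve different lengths at once.\<close>

lemma zero_count_total:
  assumes "n < K"
  shows "(\<Sum>k = 1..K. zero_count n k) = ((2 * n) choose n) ^ 3"
proof -
  have "card (common_zeros n w) \<in> {1..K}" for w
  proof -
    have "card (common_zeros n w) \<le> card {..n}"
      by (rule card_mono) (use common_zeros_le[of _ n w] in auto)
    moreover have "0 < card (common_zeros n w)"
    proof -
      have "common_zeros n w \<noteq> {}" using zero_in_common_zeros[of n w] by blast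
      then show ?thesis by (simp add: card_gt_0_iff)
    qed
    ultimately show ?thesis using assms by simp
  qed
  then have "bridge_triples n = (\<Union>k\<in>{1..K}. {w \<in> bridge_triples n. card (common_zeros n w) = k})"
    by auto
  then have "card (bridge_triples n) = (\<Sum>k = 1..K. zero_count n k)"
    unfolding zero_count_def
    by (subst card_UN_disjoint[symmetric]) (auto simp: finite_bridge_triples)
  then show ?thesis by (simp add: card_bridge_triples)
qed

lemma central_binomial_cube_renewal:
  assumes "n > 0"
  shows "((2 * n) choose n) ^ 3 = (\<Sum>j = 1..n. zero_count j 2 * ((2 * (n - j)) choose (n - j)) ^ 3)"
proof -
  have "((2 * n) choose n) ^ 3 = (\<Sum>k = 1..Suc n. zero_count n k)"
    by (rule zero_count_total[symmetric]) simp
  also have "\<dots> = (\<Sum>k = 1..n. zero_count n (Suc k))"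
  proof -
    have "(\<Sum>k = 1..Suc n. zero_count n k) = zero_count n 1 + (\<Sum>k = Suc 1..Suc n. zero_count n k)"
      by (rule sum.atLeast_Suc_atMost) simp
    also have "(\<Sum>k = Suc 1..Suc n. zero_count n k) = (\<Sum>k = 1..n. zero_count n (Suc k))"
      by (rule sum.shift_bounds_cl_Suc_ivl)
    finally show ?thesis using assms zero_count_1[of n] by simp
  qed
  also have "\<dots> = (\<Sum>k = 1..n. \<Sum>j = 1..n. zero_count j 2 * zero_count (n - j) k)"
    by (rule sum.cong[OF refl], rule zero_count_Suc) simp
  also have "\<dots> = (\<Sum>j = 1..n. \<Sum>k = 1..n. zero_count j 2 * zero_count (n - j) k)"
    by (rule sum.swap)
  also have "\<dots> = (\<Sum>j = 1..n. zero_count j 2 * (\<Sum>k = 1..n. zero_count (n - j) k))"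
    by (simp only: sum_distrib_left)
  \<comment> \<open>As \<open>j \<ge> 1\<close>, the remaining length \<open>n - j\<close> is below
    \<open>n\<close>, so the range up to \<open>n\<close> already exhausts all counts.\<close>
  also have "\<dots> = (\<Sum>j = 1..n. zero_count j 2 * ((2 * (n - j)) choose (n - j)) ^ 3)"
    by (rule sum.cong[OF refl], subst zero_count_total) auto
  finally show ?thesis .
qed

lemma prob_common_zeros:
  "measure_pmf.prob (three_srwb_pmf n) {w. card (common_zeros n w) = k}
     = real (zero_count n k) / real ((2 * n) choose n) ^ 3"
  by (simp add: three_srwb_pmf_eq measure_pmf_of_set finite_bridge_triples bridge_triples_nonempty
      zero_count_def card_bridge_triples Collect_conj_eq[symmetric] Int_def)

section \<open>Asymptotics of convolution powers and common zeros\<close>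

text \<open>The coefficient formula for powers of a power series sums over
  \<open>natpermute\<close>, which is the set of lists in \<open>convolution_fold\<close>.\<close>

lemma convolution_fold_eq_fps_power:
  assumes "k \<ge> 1"
  shows "convolution_fold k a n = fps_nth (Abs_fps a ^ k) n"
proof -
  obtain m where k: "k = Suc m" using assms by (cases k) auto
  have "{0..m} = {..<Suc m}" by auto
  then show ?thesis
    unfolding k fps_power_nth_Suc convolution_fold_def natpermute_def by simp
qed

text \<open>The indices add up to \<open>n\<close>, so the powers of \<open>c\<close> combine. This
  separates the growth \<open>64 ^ n\<close> from the summable weights.\<close>

lemma convolution_fold_scale:
  "convolution_fold k (\<lambda>n. c ^ n * b n) n = c ^ n * convolution_fold k b n"
  unfolding convolution_fold_def sum_distrib_left
proof (rule sum.cong[OF refl])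
  fix js assume "js \<in> {js. length js = k \<and> sum_list js = n}"
  then have "(\<Sum>i<k. js ! i) = n" by (auto simp: sum_list_sum_nth atLeast0LessThan)
  then show "(\<Prod>i<k. c ^ (js ! i) * b (js ! i)) = c ^ n * (\<Prod>i<k. b (js ! i))"
    by (simp add: prod.distrib power_sum[symmetric])
qed

section \<open>The concrete weights and their first-return sequence\<close>

lemma regular_weight_central_ratio_cube: "regular_weight (\<lambda>n. central_ratio n ^ 3) 8"
  by unfold_locales
    (auto intro: summable_central_ratio_cube central_ratio_cube_ratio central_ratio_cube_dom)

lemma central_ratio_cube: "real ((2 * n) choose n) ^ 3 = 64 ^ n * central_ratio n ^ 3"
proof -
  have "((4 :: real) ^ n) ^ 3 = 64 ^ n" by (simp add: power_mult[symmetric] mult.commute[of n] power_mult)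
  then show ?thesis by (simp add: central_ratio_def power_divide)
qed

text \<open>There are \<open>64 ^ n\<close> triples of paths with \<open>2 * n\<close> steps each,
  so for \<open>n > 0\<close> this is the probability that three independent walks are first back at
  0 together at time \<open>2 * n\<close>.\<close>

definition first_return :: "nat \<Rightarrow> real" where
  "first_return n = real (zero_count n 2) / 64 ^ n"

lemma first_return_0: "first_return 0 = 0"
  using zero_count_Suc[of 1 0] by (simp add: first_return_def numeral_2_eq_2)

lemma first_return_renewal:
  assumes "n > 0"
  shows "central_ratio n ^ 3 = (\<Sum>j\<le>n. first_return j * central_ratio (n - j) ^ 3)"
proof -
  have "real ((2 * n) choose n) ^ 3
      = (\<Sum>j = 1..n. real (zero_count j 2) * real ((2 * (n - j)) choose (n - j)) ^ 3)"
    using arg_cong[OF central_binomial_cube_renewal[OF assms], of real] by simp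
  also have "\<dots> = (\<Sum>j = 1..n. 64 ^ n * (first_return j * central_ratio (n - j) ^ 3))"
  proof (rule sum.cong[OF refl])
    fix j assume "j \<in> {1..n}"
    then have "(64 :: real) ^ n = 64 ^ j * 64 ^ (n - j)" by (simp flip: power_add)
    then show "real (zero_count j 2) * real ((2 * (n - j)) choose (n - j)) ^ 3
        = 64 ^ n * (first_return j * central_ratio (n - j) ^ 3)"
      by (simp only: first_return_def central_ratio_cube) simp
  qed
  also have "\<dots> = 64 ^ n * (\<Sum>j = 1..n. first_return j * central_ratio (n - j) ^ 3)"
    by (simp only: sum_distrib_left)
  \<comment> \<open>The index 0 may be added because \<open>first_return 0 = 0\<close>.\<close>
  also have "(\<Sum>j = 1..n. first_return j * central_ratio (n - j) ^ 3)
      = (\<Sum>j\<le>n. first_return j * central_ratio (n - j) ^ 3)"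
    by (rule sum.mono_neutral_left) (auto simp: first_return_0 not_less_eq_eq)
  finally show ?thesis by (simp add: central_ratio_cube)
qed

text \<open>With the time 0 included, \<open>k + 1\<close> common zeros cut a triple into
  \<open>k\<close> first-return blocks.\<close>

lemma zero_count_eq_fps_power:
  "real (zero_count n (Suc k)) / 64 ^ n = fps_nth (Abs_fps first_return ^ k) n"
proof (induction k arbitrary: n)
  case 0
  then show ?case by (simp add: zero_count_1)
next
  case (Suc k)
  have "real (zero_count n (Suc (Suc k))) / 64 ^ n
      = (\<Sum>j = 1..n. real (zero_count j 2) * real (zero_count (n - j) (Suc k)) / 64 ^ n)"
    by (simp add: zero_count_Suc sum_divide_distrib)
  also have "\<dots> = (\<Sum>j = 1..n. first_return j * fps_nth (Abs_fps first_return ^ k) (n - j))"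
    by (rule sum.cong[OF refl]) (simp add: first_return_def Suc[symmetric] power_add[symmetric])
  also have "\<dots> = (\<Sum>j = 0..n. first_return j * fps_nth (Abs_fps first_return ^ k) (n - j))"
    by (rule sum.mono_neutral_left) (auto simp: first_return_0 not_less_eq_eq)
  finally show ?case by (simp add: fps_mult_nth)
qed

theorem theorem6:
  fixes a :: "nat \<Rightarrow> real" and p :: real
  assumes "\<And>n. a n = real ((2 * n) choose n) ^ 3"
    and "p = Gamma (3 / 4) ^ 4 / pi"
  shows "(\<forall>k\<ge>1. convolution_fold k a \<sim>[sequentially]
            (\<lambda>n. exp (6 * real n * ln 2) / (real n * pi) powr (3 / 2)
                 * (pi / Gamma (3 / 4) ^ 4) ^ (k - 1) * real k))
       \<and> (\<forall>k\<ge>2. (\<lambda>n. measure_pmf.prob (three_srwb_pmf n) {w. card (common_zeros n w) = k})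
            \<longlonglongrightarrow> real (k - 1) * (1 - p) ^ (k - 2) * p\<^sup>2)"
proof (intro conjI allI impI)
  let ?w = "\<lambda>n. central_ratio n ^ 3"
  define A :: real where "A = pi / Gamma (3 / 4) ^ 4"
  interpret regular_weight ?w 8 by (rule regular_weight_central_ratio_cube)
  have nth: "fps_nth (Abs_fps f) = f" for f :: "nat \<Rightarrow> real" by (simp add: fun_eq_iff)
  have w_sum: "suminf ?w = A" unfolding A_def by (rule central_ratio_cube_sum)
  have "0 < A" unfolding A_def by (intro divide_pos_pos zero_less_power Gamma_real_pos) simp_all
  {
    fix k :: nat assume k: "k \<ge> 1"
    have fold: "convolution_fold k a n = 64 ^ n * fps_nth (Abs_fps ?w ^ k) n" for n
    proof -
      have "a = (\<lambda>n. 64 ^ n * ?w n)" using assms(1) by (simp add: fun_eq_iff central_ratio_cube)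
      then show ?thesis by (simp add: convolution_fold_scale convolution_fold_eq_fps_power[OF k])
    qed
    have "(\<lambda>n. fps_nth (Abs_fps ?w ^ k) n / ?w n) \<longlonglongrightarrow> of_nat k * A ^ (k - 1) * 1"
      unfolding w_sum[symmetric]
      using power_limit[of "Abs_fps ?w" 1 k] summable pos
      by (simp add: nth less_imp_le less_imp_neq[symmetric])
    \<comment> \<open>Replacing \<open>?w n\<close> by its asymptotics and dividing by the limit
      constant produces the quotient required for asymptotic equivalence.\<close>
    from tendsto_mult[OF tendsto_mult[OF this central_ratio_cube_limit] tendsto_const[of "1 / (real k * A ^ (k - 1))"]]
    have lim: "(\<lambda>n. fps_nth (Abs_fps ?w ^ k) n / ?w n * (?w n * (real n * pi) powr (3 / 2))
        * (1 / (real k * A ^ (k - 1)))) \<longlonglongrightarrow> 1"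
      using k \<open>0 < A\<close> by simp
    show "convolution_fold k a \<sim>[sequentially]
      (\<lambda>n. exp (6 * real n * ln 2) / (real n * pi) powr (3 / 2) * (pi / Gamma (3 / 4) ^ 4) ^ (k - 1) * real k)"
    proof (rule asymp_equivI', rule Lim_transform_eventually[OF lim])
      show "\<forall>\<^sub>F n in sequentially. fps_nth (Abs_fps ?w ^ k) n / ?w n * (?w n * (real n * pi) powr (3 / 2))
          * (1 / (real k * A ^ (k - 1)))
        = convolution_fold k a n / (exp (6 * real n * ln 2) / (real n * pi) powr (3 / 2)
          * (pi / Gamma (3 / 4) ^ 4) ^ (k - 1) * real k)"
        using eventually_gt_at_top[of 0]
      proof eventually_elim
        case (elim n)
        have "exp (6 * real n * ln 2) = exp (real n * (6 * ln 2))" by (simp add: mult_ac)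
        also have "\<dots> = exp (ln (2 ^ 6)) ^ n" by (simp only: exp_of_nat_mult ln_realpow of_nat_numeral)
        also have "\<dots> = (64 :: real) ^ n" by simp
        finally have e: "exp (6 * real n * ln 2) = (64 :: real) ^ n" .
        show ?case using elim central_ratio_pos[of n]
          unfolding fold e A_def[symmetric] by (simp add: less_imp_neq[symmetric])
      qed
    qed
  next
    fix k :: nat assume k: "k \<ge> 2"
    have fr_nonneg: "0 \<le> first_return n" for n by (simp add: first_return_def)
    have "suminf ?w < 2" by (rule central_ratio_cube_sum_less)
    note ret = renewal_limit[of first_return, OF fr_nonneg first_return_0 _ first_return_renewal this]
    \<comment> \<open>Hence \<open>first_return\<close> has sum \<open>1 - p\<close> and limiting
      ratio \<open>p^2\<close>, and \<open>power_limit\<close> with exponent \<open>k - 1\<close>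
      yields the claimed value.\<close>
    have p: "p = 1 / A" using assms(2) by (simp add: A_def)
    have "(\<lambda>n. fps_nth (Abs_fps first_return ^ (k - 1)) n / ?w n)
        \<longlonglongrightarrow> of_nat (k - 1) * (1 - p) ^ (k - 2) * p\<^sup>2"
      using power_limit[of "Abs_fps first_return" "1 / A\<^sup>2" "k - 1"] ret fr_nonneg
      by (simp add: nth w_sum p power_divide numeral_2_eq_2)
    \<comment> \<open>Numerator and denominator carry the same normalisation \<open>64 ^ n\<close>,
      so the quotient is already the probability.\<close>
    moreover have "fps_nth (Abs_fps first_return ^ (k - 1)) n / ?w n
        = measure_pmf.prob (three_srwb_pmf n) {w. card (common_zeros n w) = k}" for n
    proof -
      have "Suc (k - 1) = k" using k by simp
      then show ?thesis using zero_count_eq_fps_power[of n "k - 1", symmetric]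
        by (simp add: prob_common_zeros central_ratio_cube)
    qed
    ultimately show "(\<lambda>n. measure_pmf.prob (three_srwb_pmf n) {w. card (common_zeros n w) = k})
        \<longlonglongrightarrow> real (k - 1) * (1 - p) ^ (k - 2) * p\<^sup>2" by simp
  }
qed

end
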